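(* Let $(\mathbf{C},\mathcal{M})$ be an $\mathcal{M}$-adhesive category satisfying the horizontal VK property and having effective pushouts. Let $TG_B\xleftarrow{tg_{DB}}TG_D\xrightarrow{tg_{DC}}TG_C$, $TG_B\xrightarrow{tg_{BA}}TG_A\xleftarrow{tg_{CA}}TG_C$ be a pushout square with all morphisms in $\mathcal{M}$. Let $g_A=g_B+_{g_D}g_C$ be an amalgamation of typed objects $g_X:G_X\to TG_X$ ($X\in\{A,B,C,D\}$), let $ac_{P_A}=ac_{P_B}+_{ac_{P_D}}ac_{P_C}$ be an amalgamation of positive nested conditions, and let $p_A=p_B+_{p_D}p_C$ be corresponding matches $p_X:P_X\to G_X$. (Composition) If $Q_B$ is a solution for $p_B\vDash ac_{P_B}$ and $Q_C$ is a solution for $p_C\vDash ac_{P_C}$ and they agree in a solution $Q_D$ for $p_D\vDash ac_{P_D}$, then there is a solution $Q_A$ for $p_A\vDash ac_{P_A}$ with $Q_A=Q_B+_{Q_D}Q_C$. (Decomposition) If $Q_A$ is a solution for $p_A\vDash ac_{P_A}$, then its restrictions $Q_B,Q_C,Q_D$ are solutions for $p_B\vDash ac_{P_B}$, $p_C\vDash ac_{P_C}$, $p_D\vDash ac_{P_D}$ respectively, and $Q_A=Q_B+_{Q_D}Q_C$. Both constructions are unique up to isomorphism.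
   Context: An $\mathcal{M}$-adhesive category $(\mathbf{C},\mathcal{M})$: a category $\mathbf{C}$ with a class $\mathcal{M}$ of monomorphisms closed under isomorphisms, composition and decomposition, such that $\mathbf{C}$ has pushouts and pullbacks along $\mathcal{M}$-morphisms, $\mathcal{M}$ is stable under pushouts and pullbacks, and the vertical VK property holds (for every commutative cube with a pushout along an $\mathcal{M}$-morphism as bottom, vertical morphisms in $\mathcal{M}$ and pullbacks as back faces, the top face is a pushout iff the front faces are pullbacks). Horizontal VK property: the same condition for cubes whose horizontal morphisms are all in $\mathcal{M}$. Effective pushouts: for $a:B\to X$, $b:C\to X$ in $\mathcal{M}$ with pullback $B\leftarrow A\to C$, the morphism to $X$ induced from the pushout of $B\leftarrow A\to C$ is in $\mathcal{M}$. Typed object over $TG$: a morphism $g:G\to TG$. Restriction of $g:G\to TG$ along $t:TG'\to TG\in\mathcal{M}$: $g':G'\to TG'$ with $G'\to G$ forming a pullback square with $t$. Restriction of a morphism $a:G'\to G$ between objects typed over $TG$: the morphism between the restricted objects making the square with $a$ a pullback. With the given pushout of type objects: $g_B,g_C$ agree in $g_D$ if $g_D$ is a restriction of both; $g_A=g_B+_{g_D}g_C$ means $g_B,g_C$ agree in $g_D$, are restrictions of $g_A$, and the induced square $G_D,G_B,G_C,G_A$ is a pushout. The matches satisfy $p_A=p_B+_{p_D}p_C$ in the analogous sense with $P_X$ regarded as typed over $G_X$ via $p_X$ and the $G$'s forming the pushout above: $p_B,p_C$ are restrictions of $p_A$, $p_D$ a restriction of $p_B$ and $p_C$, and the $P$'s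 form a pushout. Positive nested conditions over $P$: $true$; $\exists(a,ac_C)$ with $a:P\to C$, $ac_C$ positive over $C$; $\bigwedge_{i\in\mathcal I}$, $\bigvee_{i\in\mathcal I}$ with $\mathcal I\ne\emptyset$. Typed over $TG$: all objects and morphisms at all nesting levels typed over $TG$ compatibly; $t_P:P\to TG$ the typing of $P$. Restriction: $true\mapsto true$, $\exists(a,ac_C)\mapsto\exists(\mathrm{Restr}_t(a),\mathrm{Restr}_t(ac_C))$, commuting with $\bigwedge,\bigvee$. $ac_{P_A}=ac_{P_B}+_{ac_{P_D}}ac_{P_C}$ means $ac_{P_D}$ is a restriction of $ac_{P_B}$ and $ac_{P_C}$, these are restrictions of $ac_{P_A}$, and $t_{P_A}=t_{P_B}+_{t_{P_D}}t_{P_C}$. Solution $Q$ for $p\vDash ac_P$ ($p:P\to G$): if $ac_P=true$, $Q=\emptyset$; if $ac_P=\exists(a,ac_C)$, $Q=(q,Q_C)$ with $q:C\to G\in\mathcal{M}$, $q\circ a=p$, $Q_C$ a solution for $q\vDash ac_C$; for $\bigwedge_i ac_{P,i}$, $Q=(Q_i)_i$ with every $Q_i$ a solution for $p\vDash ac_{P,i}$; for $\bigvee_i ac_{P,i}$, $Q=(Q_i)_i$ with $Q_j$ a solution for $p\vDash ac_{P,j}$ for some $j$ and $Q_k=\emptyset$ for $k\ne j$. Restriction of solutions is componentwise ($\emptyset\mapsto\emptyset$, $(q,Q_C)\mapsto(\mathrm{Restr}(q),\mathrm{Restr}(Q_C))$, $(Q_i)\mapsto(\mathrm{Restr}(Q_i))$),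 restricting $q:C_A\to G_A$ as a morphism typed over the $G$'s. $Q_B,Q_C$ agree in $Q_D$ if $Q_D$ is a restriction of both; $Q_A=Q_B+_{Q_D}Q_C$ means $Q_B,Q_C$ agree in $Q_D$, $Q_A$ is a solution for $p_A\vDash ac_{P_A}$, and $Q_B,Q_C$ are restrictions of $Q_A$.
   Formalization: Amalgamation of conditions also requires that, at every nesting level, the embeddings of ac_{P_D} into ac_{P_A} via ac_{P_B} and via ac_{P_C} coincide (composition fails otherwise); the morphisms q of solutions are taken to be typed over TG (needed for decomposition). *)

theory Defs
  imports Main
begin

section \<open>Categories\<close>

record ('o, 'm) cat =
  Obj :: "'o set"
  Arr :: "'m set"
  Dom :: "'m \<Rightarrow> 'o"
  Cod :: "'m \<Rightarrow> 'o"
  Idt :: "'o \<Rightarrow> 'm"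
  Comp :: "'m \<Rightarrow> 'm \<Rightarrow> 'm"  (infixr "\<cdot>\<index>" 70)

definition hom :: "('o, 'm, 'z) cat_scheme \<Rightarrow> 'o \<Rightarrow> 'o \<Rightarrow> 'm set" where
  "hom C X Y = {f \<in> Arr C. Dom C f = X \<and> Cod C f = Y}"

locale category =
  fixes C :: "('o, 'm) cat" (structure)
  assumes dom_obj: "f \<in> Arr C \<Longrightarrow> Dom C f \<in> Obj C"
    and cod_obj: "f \<in> Arr C \<Longrightarrow> Cod C f \<in> Obj C"
    and id_hom: "X \<in> Obj C \<Longrightarrow> Idt C X \<in> hom C X X"
    and comp_hom: "f \<in> hom C X Y \<Longrightarrow> g \<in> hom C Y Z \<Longrightarrow> g \<cdot> f \<in> hom C X Z"
    and id_right: "f \<in> hom C X Y \<Longrightarrow> f \<cdot> Idt C X = f"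
    and id_left: "f \<in> hom C X Y \<Longrightarrow> Idt C Y \<cdot> f = f"
    and assoc: "f \<in> hom C W X \<Longrightarrow> g \<in> hom C X Y \<Longrightarrow> h \<in> hom C Y Z \<Longrightarrow>
      h \<cdot> (g \<cdot> f) = (h \<cdot> g) \<cdot> f"

definition monic :: "('o, 'm) cat \<Rightarrow> 'm \<Rightarrow> bool" where
  "monic C f \<longleftrightarrow> f \<in> Arr C \<and>
    (\<forall>X. \<forall>x \<in> hom C X (Dom C f). \<forall>y \<in> hom C X (Dom C f).
      f \<cdot>\<^bsub>C\<^esub> x = f \<cdot>\<^bsub>C\<^esub> y \<longrightarrow> x = y)"

definition iso :: "('o, 'm) cat \<Rightarrow> 'm \<Rightarrow> bool" where
  "iso C f \<longleftrightarrow> f \<in> Arr C \<and>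
    (\<exists>g \<in> hom C (Cod C f) (Dom C f).
      g \<cdot>\<^bsub>C\<^esub> f = Idt C (Dom C f) \<and> f \<cdot>\<^bsub>C\<^esub> g = Idt C (Cod C f))"

text \<open>
  In the next three definitions the square is
  \<open>p : X \<rightarrow> Y\<close>, \<open>q : X \<rightarrow> Z\<close>, \<open>f : Y \<rightarrow> W\<close>, \<open>g : Z \<rightarrow> W\<close>.
\<close>

definition comm_square :: "('o, 'm) cat \<Rightarrow> 'm \<Rightarrow> 'm \<Rightarrow> 'm \<Rightarrow> 'm \<Rightarrow> bool" where
  "comm_square C p q f g \<longleftrightarrow>
    {p, q, f, g} \<subseteq> Arr C \<and> Dom C p = Dom C q \<and> Cod C p = Dom C f \<and>
    Cod C q = Dom C g \<and> Cod C f = Cod C g \<and> f \<cdot>\<^bsub>C\<^esub> p = g \<cdot>\<^bsub>C\<^esub> q"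

definition pullback :: "('o, 'm) cat \<Rightarrow> 'm \<Rightarrow> 'm \<Rightarrow> 'm \<Rightarrow> 'm \<Rightarrow> bool" where
  "pullback C p q f g \<longleftrightarrow> comm_square C p q f g \<and>
    (\<forall>X. \<forall>x \<in> hom C X (Dom C f). \<forall>y \<in> hom C X (Dom C g).
      f \<cdot>\<^bsub>C\<^esub> x = g \<cdot>\<^bsub>C\<^esub> y \<longrightarrow>
      (\<exists>!h. h \<in> hom C X (Dom C p) \<and> p \<cdot>\<^bsub>C\<^esub> h = x \<and> q \<cdot>\<^bsub>C\<^esub> h = y))"

definition pushout :: "('o, 'm) cat \<Rightarrow> 'm \<Rightarrow> 'm \<Rightarrow> 'm \<Rightarrow> 'm \<Rightarrow> bool" where
  "pushout C p q f g \<longleftrightarrow> comm_square C p q f g \<and>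
    (\<forall>X. \<forall>x \<in> hom C (Cod C p) X. \<forall>y \<in> hom C (Cod C q) X.
      x \<cdot>\<^bsub>C\<^esub> p = y \<cdot>\<^bsub>C\<^esub> q \<longrightarrow>
      (\<exists>!h. h \<in> hom C (Cod C f) X \<and> h \<cdot>\<^bsub>C\<^esub> f = x \<and> h \<cdot>\<^bsub>C\<^esub> g = y))"

text \<open>
  A quadruple of data on the edges \<open>D \<rightarrow> B\<close>, \<open>D \<rightarrow> C\<close>, \<open>B \<rightarrow> A\<close>, \<open>C \<rightarrow> A\<close> of a square.
\<close>

record 'a square =
  DB :: 'a
  DC :: 'a
  BA :: 'a
  CA :: 'a

definition edges :: "'a square \<Rightarrow> 'a set" where
  "edges S = {DB S, DC S, BA S, CA S}"

definition pushout_square :: "('o, 'm) cat \<Rightarrow> 'm square \<Rightarrow> bool" where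
  "pushout_square C S \<longleftrightarrow> pushout C (DB S) (DC S) (BA S) (CA S)"


section \<open>M-adhesive categories\<close>

text \<open>Cubes with bottom square \<open>S\<close>, top square \<open>S'\<close> and vertical morphisms \<open>vA, vB, vC, vD\<close>
  from top to bottom.\<close>

definition comm_cube ::
    "('o, 'm) cat \<Rightarrow> 'm square \<Rightarrow> 'm square \<Rightarrow> 'm \<Rightarrow> 'm \<Rightarrow> 'm \<Rightarrow> 'm \<Rightarrow> bool" where
  "comm_cube C S S' vA vB vC vD \<longleftrightarrow>
    comm_square C (DB S) (DC S) (BA S) (CA S) \<and>
    comm_square C (DB S') (DC S') (BA S') (CA S') \<and>
    comm_square C (DB S') vD vB (DB S) \<and>
    comm_square C (DC S') vD vC (DC S) \<and>
    comm_square C (BA S') vB vA (BA S) \<and>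
    comm_square C (CA S') vC vA (CA S)"

definition back_faces_pb ::
    "('o, 'm) cat \<Rightarrow> 'm square \<Rightarrow> 'm square \<Rightarrow> 'm \<Rightarrow> 'm \<Rightarrow> 'm \<Rightarrow> bool" where
  "back_faces_pb C S S' vB vC vD \<longleftrightarrow>
    pullback C (DB S') vD vB (DB S) \<and> pullback C (DC S') vD vC (DC S)"

definition front_faces_pb ::
    "('o, 'm) cat \<Rightarrow> 'm square \<Rightarrow> 'm square \<Rightarrow> 'm \<Rightarrow> 'm \<Rightarrow> 'm \<Rightarrow> bool" where
  "front_faces_pb C S S' vA vB vC \<longleftrightarrow>
    pullback C (BA S') vB vA (BA S) \<and> pullback C (CA S') vC vA (CA S)"

definition vertical_VK :: "('o, 'm) cat \<Rightarrow> 'm set \<Rightarrow> bool" where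
  "vertical_VK C M \<longleftrightarrow>
    (\<forall>S S' vA vB vC vD.
      pushout_square C S \<and> (DB S \<in> M \<or> DC S \<in> M) \<and> comm_cube C S S' vA vB vC vD \<and>
      {vA, vB, vC, vD} \<subseteq> M \<and> back_faces_pb C S S' vB vC vD \<longrightarrow>
      (pushout_square C S' \<longleftrightarrow> front_faces_pb C S S' vA vB vC))"

definition horizontal_VK :: "('o, 'm) cat \<Rightarrow> 'm set \<Rightarrow> bool" where
  "horizontal_VK C M \<longleftrightarrow>
    (\<forall>S S' vA vB vC vD.
      pushout_square C S \<and> comm_cube C S S' vA vB vC vD \<and>
      edges S \<subseteq> M \<and> edges S' \<subseteq> M \<and> back_faces_pb C S S' vB vC vD \<longrightarrow>
      (pushout_square C S' \<longleftrightarrow> front_faces_pb C S S' vA vB vC))"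

locale M_adhesive_category = category C
  for C :: "('o, 'm) cat" (structure) +
  fixes M :: "'m set"
  assumes M_monic: "m \<in> M \<Longrightarrow> monic C m"
    and M_iso: "iso C f \<Longrightarrow> f \<in> M"
    and M_comp: "f \<in> M \<Longrightarrow> g \<in> M \<Longrightarrow> Cod C f = Dom C g \<Longrightarrow> g \<cdot> f \<in> M"
    and M_decomp: "f \<in> Arr C \<Longrightarrow> g \<in> M \<Longrightarrow> Cod C f = Dom C g \<Longrightarrow> g \<cdot> f \<in> M \<Longrightarrow> f \<in> M"
    and M_pushouts: "m \<in> M \<Longrightarrow> f \<in> Arr C \<Longrightarrow> Dom C f = Dom C m \<Longrightarrow> \<exists>n k. pushout C f m n k"
    and M_pullbacks: "m \<in> M \<Longrightarrow> f \<in> Arr C \<Longrightarrow> Cod C f = Cod C m \<Longrightarrow> \<exists>n k. pullback C k n m f"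
    and M_pushout_stable: "m \<in> M \<Longrightarrow> pushout C f m n k \<Longrightarrow> n \<in> M"
    and M_pullback_stable: "m \<in> M \<Longrightarrow> pullback C k n m f \<Longrightarrow> n \<in> M"
    and vertical_VK: "vertical_VK C M"

definition effective_pushouts :: "('o, 'm) cat \<Rightarrow> 'm set \<Rightarrow> bool" where
  "effective_pushouts C M \<longleftrightarrow>
    (\<forall>a b p q r s x. a \<in> M \<and> b \<in> M \<and> pullback C p q a b \<and> pushout C p q r s \<and>
      x \<in> hom C (Cod C r) (Cod C a) \<and> x \<cdot>\<^bsub>C\<^esub> r = a \<and> x \<cdot>\<^bsub>C\<^esub> s = b \<longrightarrow> x \<in> M)"


section \<open>Typed objects\<close>

text \<open>
  \<open>f\<close> is a morphism from the object typed by \<open>g : G \<rightarrow> TG\<close> to the object typed by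
  \<open>h : H \<rightarrow> TG\<close>.
\<close>

definition typed_morphism :: "('o, 'm) cat \<Rightarrow> 'm \<Rightarrow> 'm \<Rightarrow> 'm \<Rightarrow> bool" where
  "typed_morphism C g h f \<longleftrightarrow> {g, h} \<subseteq> Arr C \<and> Cod C g = Cod C h \<and>
    f \<in> hom C (Dom C g) (Dom C h) \<and> h \<cdot>\<^bsub>C\<^esub> f = g"

text \<open>
  \<open>restriction C t g u g'\<close>: the typed object \<open>g' : G' \<rightarrow> TG'\<close> is a restriction of
  \<open>g : G \<rightarrow> TG\<close> along \<open>t : TG' \<rightarrow> TG\<close>, where \<open>u : G' \<rightarrow> G\<close> is the morphism
  completing the pullback square.  The restriction of a typed morphism \<open>a : X \<rightarrow> Y\<close> to a
  morphism \<open>a' : X' \<rightarrow> Y'\<close> between restricted objects, with \<open>x : X' \<rightarrow> X\<close> and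
  \<open>y : Y' \<rightarrow> Y\<close> belonging to these, is a pullback square of the same form:
  \<open>restriction C y a x a'\<close>.
\<close>

definition restriction :: "('o, 'm) cat \<Rightarrow> 'm \<Rightarrow> 'm \<Rightarrow> 'm \<Rightarrow> 'm \<Rightarrow> bool" where
  "restriction C t g u g' \<longleftrightarrow> pullback C u g' g t"

text \<open>\<open>gA = gB +\<^bsub>gD\<^esub> gC\<close> over the square \<open>TG\<close> of type objects, where \<open>G\<close> is the square
  formed by the domains.\<close>

definition agree_obj :: "('o, 'm) cat \<Rightarrow> 'm square \<Rightarrow> 'm square \<Rightarrow> 'm \<Rightarrow> 'm \<Rightarrow> 'm \<Rightarrow> bool" where
  "agree_obj C TG G gB gC gD \<longleftrightarrow>
    restriction C (DB TG) gB (DB G) gD \<and> restriction C (DC TG) gC (DC G) gD"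

definition amalgamation_obj ::
    "('o, 'm) cat \<Rightarrow> 'm square \<Rightarrow> 'm square \<Rightarrow> 'm \<Rightarrow> 'm \<Rightarrow> 'm \<Rightarrow> 'm \<Rightarrow> bool" where
  "amalgamation_obj C TG G gA gB gC gD \<longleftrightarrow>
    agree_obj C TG G gB gC gD \<and>
    restriction C (BA TG) gA (BA G) gB \<and> restriction C (CA TG) gA (CA G) gC \<and>
    pushout_square C G"


section \<open>Typed positive nested conditions\<close>

text \<open>
  \<open>CEx a t ac\<close> is \<open>\<exists>(a, ac)\<close> for \<open>a : P \<rightarrow> C\<close>, with the typing
  \<open>t : C \<rightarrow> TG\<close> recorded.  The values of a family outside its index set are irrelevant, here
  and in the datatypes below.
\<close>

datatype ('i, 'm) cond =
    CTrue
  | CEx 'm 'm "('i, 'm) cond"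
  | CAnd "'i set" "'i \<Rightarrow> ('i, 'm) cond"
  | COr "'i set" "'i \<Rightarrow> ('i, 'm) cond"

text \<open>\<open>typed_cond C tP ac\<close>: \<open>ac\<close> is a condition over the typed object
  \<open>tP : P \<rightarrow> TG\<close>.\<close>

primrec typed_cond :: "('o, 'm) cat \<Rightarrow> 'm \<Rightarrow> ('i, 'm) cond \<Rightarrow> bool" where
  "typed_cond C tP CTrue \<longleftrightarrow> tP \<in> Arr C"
| "typed_cond C tP (CEx a tC ac) \<longleftrightarrow> typed_morphism C tP tC a \<and> typed_cond C tC ac"
| "typed_cond C tP (CAnd I acs) \<longleftrightarrow> I \<noteq> {} \<and> (\<forall>i\<in>I. typed_cond C tP (acs i))"
| "typed_cond C tP (COr I acs) \<longleftrightarrow> I \<noteq> {} \<and> (\<forall>i\<in>I. typed_cond C tP (acs i))"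

text \<open>
  A restricted object determines the morphism \<open>C' \<rightarrow> C\<close> of its pullback square only up to
  automorphisms, so the restriction of a condition has to come with a choice of these morphisms at
  all nesting levels.  The choice is recorded in a tree, which the restriction of solutions refers
  to.
\<close>

datatype ('i, 'm) emb =
    ETrue
  | EEx 'm "('i, 'm) emb"
  | EFam "'i set" "'i \<Rightarrow> ('i, 'm) emb"

text \<open>\<open>cond_restriction C t u ac e ac'\<close>: \<open>ac'\<close> (over \<open>P'\<close>) is a restriction of
  \<open>ac\<close> (over \<open>P\<close>) along \<open>t : TG' \<rightarrow> TG\<close>, where \<open>u : P' \<rightarrow> P\<close>.\<close>

inductive cond_restriction ::
    "('o, 'm) cat \<Rightarrow> 'm \<Rightarrow> 'm \<Rightarrow> ('i, 'm) cond \<Rightarrow> ('i, 'm) emb \<Rightarrow> ('i, 'm) cond \<Rightarrow> bool"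
  for C t where
  "cond_restriction C t u CTrue ETrue CTrue"
| "restriction C t tC v tC' \<Longrightarrow> restriction C v a u a' \<Longrightarrow> cond_restriction C t v ac e ac' \<Longrightarrow>
    cond_restriction C t u (CEx a tC ac) (EEx v e) (CEx a' tC' ac')"
| "(\<forall>i\<in>I. cond_restriction C t u (acs i) (es i) (acs' i)) \<Longrightarrow>
    cond_restriction C t u (CAnd I acs) (EFam I es) (CAnd I acs')"
| "(\<forall>i\<in>I. cond_restriction C t u (acs i) (es i) (acs' i)) \<Longrightarrow>
    cond_restriction C t u (COr I acs) (EFam I es) (COr I acs')"

text \<open>
  Levelwise composite of trees of the same shape.  Values outside the index set are normalised so
  that equality of composites means equality at every nesting level.
\<close>

primrec emb_comp :: "('o, 'm) cat \<Rightarrow> ('i, 'm) emb \<Rightarrow> ('i, 'm) emb \<Rightarrow> ('i, 'm) emb" where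
  "emb_comp C ETrue = (\<lambda>_. ETrue)"
| "emb_comp C (EEx v e) = (\<lambda>d. case d of
      EEx w e' \<Rightarrow> EEx (v \<cdot>\<^bsub>C\<^esub> w) (emb_comp C e e') | _ \<Rightarrow> ETrue)"
| "emb_comp C (EFam I es) = (\<lambda>d. case d of
      EFam J es' \<Rightarrow> EFam I (\<lambda>i. if i \<in> I then emb_comp C (es i) (es' i) else ETrue) | _ \<Rightarrow> ETrue)"

text \<open>
  \<open>acA = acB +\<^bsub>acD\<^esub> acC\<close> over the squares \<open>TG\<close> and \<open>P\<close>, with the embeddings
  \<open>E\<close>.  As for the outermost objects, where this is part of the square \<open>P\<close> being a
  pushout, the two embeddings of each nested object of \<open>acD\<close> into that of \<open>acA\<close>, via
  \<open>acB\<close> and via \<open>acC\<close>, have to coincide.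
\<close>

definition amalgamation_cond ::
    "('o, 'm) cat \<Rightarrow> 'm square \<Rightarrow> 'm square \<Rightarrow> ('i, 'm) emb square \<Rightarrow>
     'm \<Rightarrow> 'm \<Rightarrow> 'm \<Rightarrow> 'm \<Rightarrow>
     ('i, 'm) cond \<Rightarrow> ('i, 'm) cond \<Rightarrow> ('i, 'm) cond \<Rightarrow> ('i, 'm) cond \<Rightarrow> bool" where
  "amalgamation_cond C TG P E tA tB tC tD acA acB acC acD \<longleftrightarrow>
    typed_cond C tA acA \<and> typed_cond C tB acB \<and> typed_cond C tC acC \<and> typed_cond C tD acD \<and>
    cond_restriction C (DB TG) (DB P) acB (DB E) acD \<and>
    cond_restriction C (DC TG) (DC P) acC (DC E) acD \<and>
    cond_restriction C (BA TG) (BA P) acA (BA E) acB \<and>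
    cond_restriction C (CA TG) (CA P) acA (CA E) acC \<and>
    emb_comp C (BA E) (DB E) = emb_comp C (CA E) (DC E) \<and>
    amalgamation_obj C TG P tA tB tC tD"


section \<open>Solutions\<close>

datatype ('i, 'm) sol =
    SEmpty
  | SEx 'm "('i, 'm) sol"
  | SFam "'i set" "'i \<Rightarrow> ('i, 'm) sol"

text \<open>\<open>solution C M g p ac Q\<close>: \<open>Q\<close> is a solution for \<open>p \<Turnstile> ac\<close>, where
  \<open>p : P \<rightarrow> G\<close> and \<open>G\<close> is typed by \<open>g\<close>.  All morphisms \<open>q\<close> are typed.\<close>

inductive solution ::
    "('o, 'm) cat \<Rightarrow> 'm set \<Rightarrow> 'm \<Rightarrow> 'm \<Rightarrow> ('i, 'm) cond \<Rightarrow> ('i, 'm) sol \<Rightarrow> bool"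
  for C M g where
  "solution C M g p CTrue SEmpty"
| "q \<in> M \<Longrightarrow> typed_morphism C tC g q \<Longrightarrow> q \<cdot>\<^bsub>C\<^esub> a = p \<Longrightarrow> solution C M g q ac Q \<Longrightarrow>
    solution C M g p (CEx a tC ac) (SEx q Q)"
| "(\<forall>i\<in>I. solution C M g p (acs i) (Qs i)) \<Longrightarrow> solution C M g p (CAnd I acs) (SFam I Qs)"
| "j \<in> I \<Longrightarrow> solution C M g p (acs j) (Qs j) \<Longrightarrow> (\<forall>k\<in>I. k \<noteq> j \<longrightarrow> Qs k = SEmpty) \<Longrightarrow>
    solution C M g p (COr I acs) (SFam I Qs)"

text \<open>
  \<open>sol_restriction C u e Q Q'\<close>: \<open>Q'\<close> is the restriction of \<open>Q\<close> along
  \<open>u : G' \<rightarrow> G\<close>, where \<open>e\<close> embeds the restricted condition into the original one.  The empty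
  solution also occurs at the unused members of a disjunction, hence at every \<open>e\<close>.
\<close>

inductive sol_restriction ::
    "('o, 'm) cat \<Rightarrow> 'm \<Rightarrow> ('i, 'm) emb \<Rightarrow> ('i, 'm) sol \<Rightarrow> ('i, 'm) sol \<Rightarrow> bool"
  for C u where
  "sol_restriction C u e SEmpty SEmpty"
| "restriction C u q v q' \<Longrightarrow> sol_restriction C u e Q Q' \<Longrightarrow>
    sol_restriction C u (EEx v e) (SEx q Q) (SEx q' Q')"
| "(\<forall>i\<in>I. sol_restriction C u (es i) (Qs i) (Qs' i)) \<Longrightarrow>
    sol_restriction C u (EFam I es) (SFam I Qs) (SFam I Qs')"

definition agree_sol ::
    "('o, 'm) cat \<Rightarrow> 'm square \<Rightarrow> ('i, 'm) emb square \<Rightarrow>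
     ('i, 'm) sol \<Rightarrow> ('i, 'm) sol \<Rightarrow> ('i, 'm) sol \<Rightarrow> bool" where
  "agree_sol C G E QB QC QD \<longleftrightarrow>
    sol_restriction C (DB G) (DB E) QB QD \<and> sol_restriction C (DC G) (DC E) QC QD"

text \<open>\<open>QA = QB +\<^bsub>QD\<^esub> QC\<close>\<close>

definition amalgamation_sol ::
    "('o, 'm) cat \<Rightarrow> 'm set \<Rightarrow> 'm square \<Rightarrow> ('i, 'm) emb square \<Rightarrow> 'm \<Rightarrow> 'm \<Rightarrow> ('i, 'm) cond \<Rightarrow>
     ('i, 'm) sol \<Rightarrow> ('i, 'm) sol \<Rightarrow> ('i, 'm) sol \<Rightarrow> ('i, 'm) sol \<Rightarrow> bool" where
  "amalgamation_sol C M G E gA pA acA QA QB QC QD \<longleftrightarrow>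
    agree_sol C G E QB QC QD \<and> solution C M gA pA acA QA \<and>
    sol_restriction C (BA G) (BA E) QA QB \<and> sol_restriction C (CA G) (CA E) QA QC"

text \<open>The restrictions of \<open>QA\<close> to the parts \<open>B\<close>, \<open>C\<close> and \<open>D\<close>.\<close>

definition restrictions_sol ::
    "('o, 'm) cat \<Rightarrow> 'm square \<Rightarrow> ('i, 'm) emb square \<Rightarrow>
     ('i, 'm) sol \<Rightarrow> ('i, 'm) sol \<Rightarrow> ('i, 'm) sol \<Rightarrow> ('i, 'm) sol \<Rightarrow> bool" where
  "restrictions_sol C G E QA QB QC QD \<longleftrightarrow>
    sol_restriction C (BA G) (BA E) QA QB \<and> sol_restriction C (CA G) (CA E) QA QC \<and>
    sol_restriction C (BA G \<cdot>\<^bsub>C\<^esub> DB G) (emb_comp C (BA E) (DB E)) QA QD"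

text \<open>
  Isomorphism of solutions in the same object \<open>G\<close>.  The morphisms \<open>q\<close> of a solution are
  monic, so the isomorphisms at different nesting levels automatically commute with the morphisms of
  the condition, with its typing, and with the embeddings of restricted objects.
\<close>

inductive sol_iso :: "('o, 'm) cat \<Rightarrow> ('i, 'm) sol \<Rightarrow> ('i, 'm) sol \<Rightarrow> bool"
  for C where
  "sol_iso C SEmpty SEmpty"
| "iso C i \<Longrightarrow> i \<in> hom C (Dom C q) (Dom C q') \<Longrightarrow> Cod C q = Cod C q' \<Longrightarrow> q' \<cdot>\<^bsub>C\<^esub> i = q \<Longrightarrow>
    sol_iso C Q Q' \<Longrightarrow> sol_iso C (SEx q Q) (SEx q' Q')"
| "(\<forall>i\<in>I. sol_iso C (Qs i) (Qs' i)) \<Longrightarrow> sol_iso C (SFam I Qs) (SFam I Qs')"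

end

theory Submission
  imports Defs
begin

text \<open>
  By the horizontal VK property, the restrictions of every nested object of the condition form a
  pushout again.  Compatible morphisms \<open>qB\<close>, \<open>qC\<close> of two solutions therefore induce a unique
  \<open>qA\<close>, and the VK property, now over the pushout of the \<open>G\<close>'s, says that they are its
  restrictions.  Since pushouts along M-morphisms are pullbacks, \<open>C\<^sub>D\<close> is the intersection of
  \<open>C\<^sub>B\<close> and \<open>C\<^sub>C\<close> in \<open>G\<^sub>A\<close>, so \<open>qA\<close> is in M by effectiveness.  Conversely a typed
  morphism has a restriction because the type square is a pullback.  Induction on the condition
  lifts this from morphisms to solutions.
\<close>

section \<open>Pullbacks and pushouts\<close>

text \<open>Restrictions are pullbacks and fix their objects only up to isomorphism, so everything
  is relative to embeddings chosen at all nesting levels. Once these are fixed, the arrows of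
  restricted and amalgamated solutions are equal, not just isomorphic, and uniqueness amounts to
  cancelling a monic or a jointly epic pair. The invariant of the induction for composition is that
  the matches are amalgamated: below an existential the square \<open>V\<close> of nested objects
  replaces \<open>P\<close>, and the arrows \<open>qA\<close>, \<open>qB\<close>, \<open>qC\<close>,
  \<open>qD\<close> replace the matches. The awkward case is disjunction. A solution does not record
  its selected disjunct, and a selected \<open>CTrue\<close> has the same empty solution as an
  unselected disjunct, so the parts may disagree about the choice. Restriction preserves and
  reflects emptiness, and that is what the parts share.\<close>

lemma comm_square_iff:
  "comm_square C p q f g \<longleftrightarrow> p \<in> Arr C \<and> q \<in> Arr C \<and> f \<in> Arr C \<and> g \<in> Arr C \<and>
    Dom C p = Dom C q \<and> Cod C p = Dom C f \<and> Cod C q = Dom C g \<and> Cod C f = Cod C g \<and>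
    f \<cdot>\<^bsub>C\<^esub> p = g \<cdot>\<^bsub>C\<^esub> q"
  by (auto simp: comm_square_def)

lemma pullback_comm: "pullback C p q f g \<Longrightarrow> comm_square C p q f g"
  by (simp add: pullback_def)

lemma pushout_comm: "pushout C p q f g \<Longrightarrow> comm_square C p q f g"
  by (simp add: pushout_def)

lemma monicD:
  assumes "monic C f" "x \<in> Arr C" "y \<in> Arr C" "Dom C x = Dom C y"
    "Cod C x = Dom C f" "Cod C y = Dom C f" "f \<cdot>\<^bsub>C\<^esub> x = f \<cdot>\<^bsub>C\<^esub> y"
  shows "x = y"
  using assms by (auto simp: monic_def hom_def)

section \<open>Composition with explicit domains and codomains\<close>

context category
begin

lemma comp_arr:
  assumes "f \<in> Arr C" "g \<in> Arr C" "Cod C f = Dom C g"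
  shows comp_in_Arr: "g \<cdot> f \<in> Arr C"
    and Dom_comp: "Dom C (g \<cdot> f) = Dom C f"
    and Cod_comp: "Cod C (g \<cdot> f) = Cod C g"
  using comp_hom[of f "Dom C f" "Cod C f" g "Cod C g"] assms by (auto simp: hom_def)

lemma comp_assoc:
  assumes "f \<in> Arr C" "g \<in> Arr C" "h \<in> Arr C" "Cod C f = Dom C g" "Cod C g = Dom C h"
  shows "(h \<cdot> g) \<cdot> f = h \<cdot> (g \<cdot> f)"
  using assoc[of f "Dom C f" "Cod C f" g "Cod C g" h "Cod C h"] assms by (auto simp: hom_def)

text \<open>Whiskering of a commuting square. Both reassociations are done at once because
  associativity is available only under domain and codomain conditions.\<close>

lemma comp_cong_right:
  assumes "f \<cdot> x = g \<cdot> y" "f \<in> Arr C" "g \<in> Arr C" "x \<in> Arr C" "y \<in> Arr C" "h \<in> Arr C"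
    "Cod C x = Dom C f" "Cod C y = Dom C g" "Cod C h = Dom C x" "Dom C y = Dom C x"
  shows "f \<cdot> (x \<cdot> h) = g \<cdot> (y \<cdot> h)"
  using assms comp_assoc[of h x f] comp_assoc[of h y g] by simp

lemma comp_cong_left:
  assumes "f \<cdot> x = g \<cdot> y" "f \<in> Arr C" "g \<in> Arr C" "x \<in> Arr C" "y \<in> Arr C" "h \<in> Arr C"
    "Cod C x = Dom C f" "Cod C y = Dom C g" "Dom C h = Cod C f" "Cod C g = Cod C f"
  shows "(h \<cdot> f) \<cdot> x = (h \<cdot> g) \<cdot> y"
  using assms comp_assoc[of x f h] comp_assoc[of y g h] by simp

lemma Idt_arr:
  assumes "X \<in> Obj C"
  shows Idt_in_Arr: "Idt C X \<in> Arr C" and Dom_Idt: "Dom C (Idt C X) = X"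
    and Cod_Idt: "Cod C (Idt C X) = X"
  using id_hom[OF assms] by (auto simp: hom_def)

lemma comp_Idt: "f \<in> Arr C \<Longrightarrow> f \<cdot> Idt C (Dom C f) = f"
  by (rule id_right[of f _ "Cod C f"]) (simp add: hom_def)

lemma Idt_comp: "f \<in> Arr C \<Longrightarrow> Idt C (Cod C f) \<cdot> f = f"
  by (rule id_left[of f "Dom C f"]) (simp add: hom_def)

lemmas cat_simps = comp_arr Idt_arr comp_Idt Idt_comp dom_obj cod_obj

lemma iso_Idt: "X \<in> Obj C \<Longrightarrow> iso C (Idt C X)"
  using id_hom[of X] id_right[of "Idt C X" X X] by (auto simp: iso_def hom_def)

section \<open>Pullbacks: universal property, symmetry and pasting\<close>

lemma pullback_lift:
  assumes "pullback C p q f g" "x \<in> Arr C" "y \<in> Arr C" "Dom C x = Dom C y"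
    "Cod C x = Dom C f" "Cod C y = Dom C g" "f \<cdot> x = g \<cdot> y"
  obtains h where "h \<in> Arr C" "Dom C h = Dom C x" "Cod C h = Dom C p" "p \<cdot> h = x" "q \<cdot> h = y"
proof -
  have "x \<in> hom C (Dom C x) (Dom C f)" "y \<in> hom C (Dom C x) (Dom C g)"
    using assms by (simp_all add: hom_def)
  then have "\<exists>!h. h \<in> hom C (Dom C x) (Dom C p) \<and> p \<cdot> h = x \<and> q \<cdot> h = y"
    using assms(1,7) unfolding pullback_def by blast
  then obtain h where "h \<in> hom C (Dom C x) (Dom C p)" "p \<cdot> h = x" "q \<cdot> h = y"
    by blast
  then show thesis
    using that[of h] by (simp add: hom_def)
qed

lemma pullback_joint_monic:
  assumes "pullback C p q f g" "h \<in> Arr C" "k \<in> Arr C" "Dom C h = Dom C k"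
    "Cod C h = Dom C p" "Cod C k = Dom C p" "p \<cdot> h = p \<cdot> k" "q \<cdot> h = q \<cdot> k"
  shows "h = k"
proof -
  have c: "comm_square C p q f g" using assms(1) by (rule pullback_comm)
  have "f \<cdot> (p \<cdot> h) = g \<cdot> (q \<cdot> h)"
    by (rule comp_cong_right) (use c assms in \<open>simp_all add: comm_square_iff\<close>)
  moreover have "p \<cdot> h \<in> hom C (Dom C h) (Dom C f)" "q \<cdot> h \<in> hom C (Dom C h) (Dom C g)"
    using c assms by (simp_all add: comm_square_iff hom_def cat_simps)
  ultimately have "\<exists>!l. l \<in> hom C (Dom C h) (Dom C p) \<and> p \<cdot> l = p \<cdot> h \<and> q \<cdot> l = q \<cdot> h"
    using assms(1) unfolding pullback_def by blast
  moreover have "h \<in> hom C (Dom C h) (Dom C p)" "k \<in> hom C (Dom C h) (Dom C p)"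
    using assms by (simp_all add: hom_def)
  ultimately show ?thesis
    using assms(7,8) by metis
qed

text \<open>Existence and uniqueness of the mediating arrow are separated because they have
  different sources below: lifts are composed, while uniqueness comes from cancelling identities,
  monics or jointly monic projections.\<close>

lemma pullbackI:
  assumes "comm_square C p q f g"
    and "\<And>x y. x \<in> Arr C \<Longrightarrow> y \<in> Arr C \<Longrightarrow> Dom C x = Dom C y \<Longrightarrow> Cod C x = Dom C f \<Longrightarrow>
      Cod C y = Dom C g \<Longrightarrow> f \<cdot> x = g \<cdot> y \<Longrightarrow>
      \<exists>h. h \<in> Arr C \<and> Dom C h = Dom C x \<and> Cod C h = Dom C p \<and> p \<cdot> h = x \<and> q \<cdot> h = y"
    and "\<And>h k. h \<in> Arr C \<Longrightarrow> k \<in> Arr C \<Longrightarrow> Dom C h = Dom C k \<Longrightarrow> Cod C h = Dom C p \<Longrightarrow>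
      Cod C k = Dom C p \<Longrightarrow> p \<cdot> h = p \<cdot> k \<Longrightarrow> q \<cdot> h = q \<cdot> k \<Longrightarrow> h = k"
  shows "pullback C p q f g"
  unfolding pullback_def
proof (intro conjI allI ballI impI)
  fix X x y
  assume x: "x \<in> hom C X (Dom C f)" and y: "y \<in> hom C X (Dom C g)" and e: "f \<cdot> x = g \<cdot> y"
  obtain h where "h \<in> Arr C" "Dom C h = X" "Cod C h = Dom C p" "p \<cdot> h = x" "q \<cdot> h = y"
    using assms(2)[of x y] x y e by (auto simp: hom_def)
  then show "\<exists>!h. h \<in> hom C X (Dom C p) \<and> p \<cdot> h = x \<and> q \<cdot> h = y"
    by (intro ex1I[of _ h]) (auto simp: hom_def intro: assms(3))
qed (rule assms(1))

lemma pullback_flip: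
  assumes "pullback C p q f g"
  shows "pullback C q p g f"
proof (rule pullbackI)
  have c: "comm_square C p q f g" using assms by (rule pullback_comm)
  then show "comm_square C q p g f" by (auto simp: comm_square_iff)
  show "\<exists>h. h \<in> Arr C \<and> Dom C h = Dom C x \<and> Cod C h = Dom C q \<and> q \<cdot> h = x \<and> p \<cdot> h = y"
    if xy: "x \<in> Arr C" "y \<in> Arr C" "Dom C x = Dom C y" "Cod C x = Dom C g" "Cod C y = Dom C f"
      "g \<cdot> x = f \<cdot> y" for x y
  proof -
    obtain h where "h \<in> Arr C" "Dom C h = Dom C y" "Cod C h = Dom C p" "p \<cdot> h = y" "q \<cdot> h = x"
      using pullback_lift[OF assms xy(2,1) xy(3)[symmetric] xy(5,4) xy(6)[symmetric]] .
    then show ?thesis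
      using xy(3) c[unfolded comm_square_iff] by (intro exI[of _ h]) simp
  qed
  show "h = k" if "h \<in> Arr C" "k \<in> Arr C" "Dom C h = Dom C k" "Cod C h = Dom C q"
    "Cod C k = Dom C q" "q \<cdot> h = q \<cdot> k" "p \<cdot> h = p \<cdot> k" for h k
    using pullback_joint_monic[OF assms, of h k] that c by (simp add: comm_square_iff)
qed

text \<open>Kept as an equivalence: cancellation turns a restriction of typed objects into one of
  morphisms, and both directions together compare restriction along a composite with restriction in
  two stages.\<close>

lemma pullback_paste_iff:
  assumes pb: "pullback C u g' g t" and c': "comm_square C u' g'' g' t'"
  shows "pullback C (u \<cdot> u') g'' g (t \<cdot> t') \<longleftrightarrow> pullback C u' g'' g' t'"
proof -
  have c: "comm_square C u g' g t" using pb by (rule pullback_comm)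
  note cs = c[unfolded comm_square_iff] c'[unfolded comm_square_iff]
  have outer: "comm_square C (u \<cdot> u') g'' g (t \<cdot> t')"
    using cs comp_assoc[of u' u g] comp_assoc[of g'' t' t] comp_assoc[of u' g' t]
    by (simp add: comm_square_iff cat_simps)
  show ?thesis
  proof
    assume big: "pullback C (u \<cdot> u') g'' g (t \<cdot> t')"
    show "pullback C u' g'' g' t'"
    proof (rule pullbackI[OF c'])
      fix x y
      assume x: "x \<in> Arr C" "y \<in> Arr C" "Dom C x = Dom C y" "Cod C x = Dom C g'"
        "Cod C y = Dom C t'" "g' \<cdot> x = t' \<cdot> y"
      have "g \<cdot> (u \<cdot> x) = t \<cdot> (g' \<cdot> x)"
        using cs x by - (rule comp_cong_right; auto)
      also have "\<dots> = (t \<cdot> t') \<cdot> y"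
        using cs x by (simp add: comp_assoc)
      finally obtain h where h: "h \<in> Arr C" "Dom C h = Dom C x" "Cod C h = Dom C u'"
        "(u \<cdot> u') \<cdot> h = u \<cdot> x" "g'' \<cdot> h = y"
        using pullback_lift[OF big, of "u \<cdot> x" y] cs x by (auto simp: cat_simps)
      have "g' \<cdot> (u' \<cdot> h) = t' \<cdot> (g'' \<cdot> h)"
        using cs h by - (rule comp_cong_right; auto)
      \<comment> \<open>The outer square gives agreement only after composing with \<open>u\<close>;
        the equation for \<open>g'\<close> supplies the other projection of the given
        pullback.\<close>
      then have "u' \<cdot> h = x"
        using cs h x by - (rule pullback_joint_monic[OF pb]; auto simp: cat_simps comp_assoc)
      then show "\<exists>h. h \<in> Arr C \<and> Dom C h = Dom C x \<and> Cod C h = Dom C u' \<and> u' \<cdot> h = x \<and> g'' \<cdot> h = y"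
        using h by auto
    next
      fix h k
      assume h: "h \<in> Arr C" "k \<in> Arr C" "Dom C h = Dom C k" "Cod C h = Dom C u'"
        "Cod C k = Dom C u'" "u' \<cdot> h = u' \<cdot> k" "g'' \<cdot> h = g'' \<cdot> k"
      then show "h = k"
        using cs by - (rule pullback_joint_monic[OF big]; auto simp: cat_simps comp_assoc)
    qed
  next
    assume small: "pullback C u' g'' g' t'"
    show "pullback C (u \<cdot> u') g'' g (t \<cdot> t')"
    proof (rule pullbackI[OF outer])
      fix x y
      assume x: "x \<in> Arr C" "y \<in> Arr C" "Dom C x = Dom C y" "Cod C x = Dom C g"
        "Cod C y = Dom C (t \<cdot> t')" "g \<cdot> x = (t \<cdot> t') \<cdot> y"
      have y: "Cod C y = Dom C t'" using x(5) cs by (simp add: cat_simps)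
      have "g \<cdot> x = t \<cdot> (t' \<cdot> y)" using cs x y by (simp add: comp_assoc)
      then obtain h where h: "h \<in> Arr C" "Dom C h = Dom C x" "Cod C h = Dom C u"
        "u \<cdot> h = x" "g' \<cdot> h = t' \<cdot> y"
        using pullback_lift[OF pb, of x "t' \<cdot> y"] cs x y by (auto simp: cat_simps)
      obtain k where k: "k \<in> Arr C" "Dom C k = Dom C h" "Cod C k = Dom C u'"
        "u' \<cdot> k = h" "g'' \<cdot> k = y"
        using pullback_lift[OF small, of h y] cs x y h by auto
      show "\<exists>h. h \<in> Arr C \<and> Dom C h = Dom C x \<and> Cod C h = Dom C (u \<cdot> u') \<and>
          (u \<cdot> u') \<cdot> h = x \<and> g'' \<cdot> h = y"
        using k h cs by (intro exI[of _ k]) (auto simp: cat_simps comp_assoc)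
    next
      fix h k
      assume h: "h \<in> Arr C" "k \<in> Arr C" "Dom C h = Dom C k" "Cod C h = Dom C (u \<cdot> u')"
        "Cod C k = Dom C (u \<cdot> u')" "(u \<cdot> u') \<cdot> h = (u \<cdot> u') \<cdot> k" "g'' \<cdot> h = g'' \<cdot> k"
      have cod: "Cod C h = Dom C u'" "Cod C k = Dom C u'"
        using h cs by (simp_all add: cat_simps)
      have "g' \<cdot> (u' \<cdot> h) = t' \<cdot> (g'' \<cdot> h)" "g' \<cdot> (u' \<cdot> k) = t' \<cdot> (g'' \<cdot> k)"
        using cs h cod by - (rule comp_cong_right; auto)+
      then have "u' \<cdot> h = u' \<cdot> k"
        using cs h cod by - (rule pullback_joint_monic[OF pb]; auto simp: cat_simps comp_assoc)
      then show "h = k"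
        using cs h cod by - (rule pullback_joint_monic[OF small]; auto)
    qed
  qed
qed

section \<open>Pushouts: symmetry and universal property\<close>

lemma pushout_flip:
  assumes "pushout C p q f g"
  shows "pushout C q p g f"
  unfolding pushout_def
proof (intro conjI allI ballI impI)
  show "comm_square C q p g f" using pushout_comm[OF assms] by (auto simp: comm_square_iff)
  fix X x y
  assume x: "x \<in> hom C (Cod C q) X" "y \<in> hom C (Cod C p) X" "x \<cdot> q = y \<cdot> p"
  then have "\<exists>!h. h \<in> hom C (Cod C f) X \<and> h \<cdot> f = y \<and> h \<cdot> g = x"
    using assms x(3)[symmetric] unfolding pushout_def by blast
  moreover have "Cod C f = Cod C g" using pushout_comm[OF assms] by (simp add: comm_square_iff)
  ultimately show "\<exists>!h. h \<in> hom C (Cod C g) X \<and> h \<cdot> g = x \<and> h \<cdot> f = y"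
    by (simp add: conj_commute)
qed

lemma pushout_desc:
  assumes "pushout C p q f g" "x \<in> Arr C" "y \<in> Arr C" "Cod C x = Cod C y"
    "Dom C x = Cod C p" "Dom C y = Cod C q" "x \<cdot> p = y \<cdot> q"
  obtains h where "h \<in> Arr C" "Dom C h = Cod C f" "Cod C h = Cod C x" "h \<cdot> f = x" "h \<cdot> g = y"
proof -
  have "x \<in> hom C (Cod C p) (Cod C x)" "y \<in> hom C (Cod C q) (Cod C x)"
    using assms by (simp_all add: hom_def)
  then have "\<exists>!h. h \<in> hom C (Cod C f) (Cod C x) \<and> h \<cdot> f = x \<and> h \<cdot> g = y"
    using assms(1,7) unfolding pushout_def by blast
  then obtain h where "h \<in> hom C (Cod C f) (Cod C x)" "h \<cdot> f = x" "h \<cdot> g = y"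
    by blast
  then show thesis
    using that[of h] by (simp add: hom_def)
qed

lemma pushout_joint_epic:
  assumes "pushout C p q f g" "h \<in> Arr C" "k \<in> Arr C" "Cod C h = Cod C k"
    "Dom C h = Cod C f" "Dom C k = Cod C f" "h \<cdot> f = k \<cdot> f" "h \<cdot> g = k \<cdot> g"
  shows "h = k"
proof -
  have c: "comm_square C p q f g" using assms(1) by (rule pushout_comm)
  have "(h \<cdot> f) \<cdot> p = (h \<cdot> g) \<cdot> q"
    by (rule comp_cong_left) (use c assms in \<open>simp_all add: comm_square_iff\<close>)
  moreover have "h \<cdot> f \<in> hom C (Cod C p) (Cod C h)" "h \<cdot> g \<in> hom C (Cod C q) (Cod C h)"
    using c assms by (simp_all add: comm_square_iff hom_def cat_simps)
  ultimately have "\<exists>!l. l \<in> hom C (Cod C f) (Cod C h) \<and> l \<cdot> f = h \<cdot> f \<and> l \<cdot> g = h \<cdot> g"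
    using assms(1) unfolding pushout_def by blast
  moreover have "h \<in> hom C (Cod C f) (Cod C h)" "k \<in> hom C (Cod C f) (Cod C h)"
    using assms by (simp_all add: hom_def)
  ultimately show ?thesis
    using assms(7,8) by metis
qed

end

section \<open>Consequences of M-adhesiveness\<close>

context M_adhesive_category
begin

lemma M_Idt: "X \<in> Obj C \<Longrightarrow> Idt C X \<in> M"
  by (simp add: M_iso iso_Idt)

lemma restriction_M: "restriction C t g u g' \<Longrightarrow> t \<in> M \<Longrightarrow> u \<in> M"
  unfolding restriction_def using M_pullback_stable pullback_flip by blast

text \<open>The vertical VK property is applied to the cube over the given square whose top square has
  two opposite identities and whose verticals are \<open>k\<close>, \<open>p\<close> and two identities: one of its
  front faces is the given square.\<close>

lemma pushout_pullback:
  assumes po: "pushout C p q f k" and p: "p \<in> M"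
  shows "pullback C p q f k"
proof -
  note cs = po[THEN pushout_comm, unfolded comm_square_iff]
  \<comment> \<open>The vertical VK property asks for all verticals in \<open>M\<close>, and
    \<open>k\<close> becomes one of them.\<close>
  have k: "k \<in> M"
  proof -
    have "pushout C q p k f"
      using po by (rule pushout_flip)
    then show ?thesis using p by (rule M_pushout_stable[rotated])
  qed
  define d where "d = Idt C (Dom C p)"
  define c where "c = Idt C (Cod C q)"
  have d: "d \<in> M" "d \<in> Arr C" "Dom C d = Dom C p" "Cod C d = Dom C p" "q \<cdot> d = q" "p \<cdot> d = p"
    and c: "c \<in> M" "c \<in> Arr C" "Dom C c = Cod C q" "Cod C c = Cod C q" "c \<cdot> q = q" "k \<cdot> c = k"
    unfolding d_def c_def using cs comp_Idt[of p] comp_Idt[of q] Idt_comp[of q] comp_Idt[of k]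
    by (simp_all add: Idt_arr dom_obj cod_obj M_Idt)
  have d_left: "d \<cdot> x = x" if "x \<in> Arr C" "Cod C x = Dom C p" for x
    unfolding d_def using that Idt_comp[of x] by simp
  have c_left: "c \<cdot> x = x" if "x \<in> Arr C" "Cod C x = Cod C q" for x
    unfolding c_def using that Idt_comp[of x] by simp
  have top: "pushout C d q q c"
    unfolding pushout_def
  proof (intro conjI allI ballI impI)
    show "comm_square C d q q c" using cs d c by (simp add: comm_square_iff)
    fix X x y
    assume x: "x \<in> hom C (Cod C d) X" "y \<in> hom C (Cod C q) X" "x \<cdot> d = y \<cdot> q"
    have z: "z \<cdot> c = z" if "z \<in> hom C (Cod C q) X" for z
      unfolding c_def using that by (rule id_right)
    have "x \<cdot> d = x"
      unfolding d_def by (rule id_right[of x _ X]) (use x(1) d(4) in simp)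
    then have "y \<cdot> q = x" using x(3) by simp
    then show "\<exists>!h. h \<in> hom C (Cod C q) X \<and> h \<cdot> q = x \<and> h \<cdot> c = y"
      using z x(2) by metis
  qed
  \<comment> \<open>With \<open>d\<close> an identity, this back face is a pullback exactly because
    \<open>p\<close> is monic.\<close>
  have b1: "pullback C d d p p"
  proof (rule pullbackI)
    show "comm_square C d d p p" using cs d by (simp add: comm_square_iff)
    fix x y
    assume x: "x \<in> Arr C" "y \<in> Arr C" "Dom C x = Dom C y" "Cod C x = Dom C p"
        "Cod C y = Dom C p" "p \<cdot> x = p \<cdot> y"
    have "x = y" by (rule monicD[OF M_monic[OF p] x])
    then show "\<exists>h. h \<in> Arr C \<and> Dom C h = Dom C x \<and> Cod C h = Dom C d \<and> d \<cdot> h = x \<and> d \<cdot> h = y"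
      using x(1,4) d(3) d_left by (intro exI[of _ x]) simp
  next
    fix h l
    assume "h \<in> Arr C" "l \<in> Arr C" "Cod C h = Dom C d" "Cod C l = Dom C d" "d \<cdot> h = d \<cdot> l"
    then show "h = l" using d_left[of h] d_left[of l] d(3) by simp
  qed
  have b2: "pullback C q d c q"
  proof (rule pullbackI)
    show "comm_square C q d c q" using cs d c by (simp add: comm_square_iff)
    fix x y
    assume x: "x \<in> Arr C" "y \<in> Arr C" "Dom C x = Dom C y" "Cod C x = Dom C c"
        "Cod C y = Dom C q" "c \<cdot> x = q \<cdot> y"
    have "q \<cdot> y = x" using x c c_left[of x] by simp
    moreover have "d \<cdot> y = y" using x(2,5) cs by (intro d_left) auto
    ultimately show "\<exists>h. h \<in> Arr C \<and> Dom C h = Dom C x \<and> Cod C h = Dom C q \<and> q \<cdot> h = x \<and> d \<cdot> h = y"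
      using x(2,3,5) by (intro exI[of _ y]) simp
  next
    fix h l
    assume "h \<in> Arr C" "l \<in> Arr C" "Cod C h = Dom C q" "Cod C l = Dom C q" "d \<cdot> h = d \<cdot> l"
    then show "h = l" using d_left[of h] d_left[of l] cs by simp
  qed
  let ?S = "\<lparr>DB = p, DC = q, BA = f, CA = k\<rparr>"
  let ?S' = "\<lparr>DB = d, DC = q, BA = q, CA = c\<rparr>"
  have "comm_cube C ?S ?S' k p c d"
    unfolding comm_cube_def comm_square_iff using cs c d by simp
  then have "pushout_square C ?S' \<longleftrightarrow> front_faces_pb C ?S ?S' k p c"
    using po p k c(1) d(1) b1 b2
    by (intro vertical_VK[unfolded vertical_VK_def, rule_format])
      (simp add: pushout_square_def back_faces_pb_def)
  then have "pullback C q p k f"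
    using top by (simp add: pushout_square_def front_faces_pb_def)
  then show ?thesis by (rule pullback_flip)
qed

section \<open>Amalgamation of typed objects and morphisms\<close>

lemma amalgamation_obj_M:
  assumes "amalgamation_obj C TG G gA gB gC gD" and "edges TG \<subseteq> M"
  shows "edges G \<subseteq> M"
  using assms restriction_M
  unfolding amalgamation_obj_def agree_obj_def edges_def by blast

text \<open>Horizontal VK read from the front faces to the top, over the bottom \<open>TG\<close>.
  The equation \<open>eq\<close> has to be supplied: each embedding is fixed only up to
  automorphism, so four restrictions alone do not force the two composites to coincide.\<close>

lemma amalgamation_objI:
  assumes hvk: "horizontal_VK C M" and po: "pushout_square C TG" and TG: "edges TG \<subseteq> M"
    and r: "restriction C (DB TG) tB (DB V) tD" "restriction C (DC TG) tC (DC V) tD"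
      "restriction C (BA TG) tA (BA V) tB" "restriction C (CA TG) tA (CA V) tC"
    and eq: "BA V \<cdot> DB V = CA V \<cdot> DC V"
  shows "amalgamation_obj C TG V tA tB tC tD"
proof -
  note pbs = r[unfolded restriction_def]
  note cs = pbs[THEN pullback_comm]
  have "edges V \<subseteq> M"
    using r TG restriction_M unfolding edges_def by blast
  moreover have "comm_cube C TG V tA tB tC tD"
    using cs eq po pushout_comm[of C "DB TG" "DC TG" "BA TG" "CA TG"]
    unfolding comm_cube_def pushout_square_def by (simp add: comm_square_iff)
  ultimately have "pushout_square C V \<longleftrightarrow> front_faces_pb C TG V tA tB tC"
    using hvk po TG pbs unfolding horizontal_VK_def back_faces_pb_def by blast
  then show ?thesis
    using r pbs unfolding amalgamation_obj_def agree_obj_def front_faces_pb_def by simp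
qed

text \<open>Subobjects of \<open>B\<close> and \<open>C\<close> that agree in \<open>D\<close> intersect, inside \<open>A\<close>, in their common
  part over \<open>D\<close>; this makes effective pushouts applicable.\<close>

lemma agree_pullback:
  assumes pbG: "pullback C (DB G) (DC G) (BA G) (CA G)"
    and rB: "restriction C (DB G) qB (DB V) qD" and rC: "restriction C (DC G) qC (DC V) qD"
    and qD: "qD \<in> M"
  shows "pullback C (DB V) (DC V) (BA G \<cdot> qB) (CA G \<cdot> qC)"
proof (rule pullbackI)
  note pbB = rB[unfolded restriction_def] and pbC = rC[unfolded restriction_def]
  note cs = pbG[THEN pullback_comm, unfolded comm_square_iff]
    pbB[THEN pullback_comm, unfolded comm_square_iff]
    pbC[THEN pullback_comm, unfolded comm_square_iff]
  have "(BA G \<cdot> qB) \<cdot> DB V = (BA G \<cdot> DB G) \<cdot> qD"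
    using cs by - (rule comp_cong_left; auto)
  also have "\<dots> = (CA G \<cdot> qC) \<cdot> DC V"
    using cs comp_cong_left[of "DC G" qD qC "DC V" "CA G"] by auto
  finally show "comm_square C (DB V) (DC V) (BA G \<cdot> qB) (CA G \<cdot> qC)"
    using cs by (simp add: comm_square_iff cat_simps)
  fix x y
  assume x: "x \<in> Arr C" "y \<in> Arr C" "Dom C x = Dom C y" "Cod C x = Dom C (BA G \<cdot> qB)"
    "Cod C y = Dom C (CA G \<cdot> qC)" "(BA G \<cdot> qB) \<cdot> x = (CA G \<cdot> qC) \<cdot> y"
  have cx: "Cod C x = Dom C qB" "Cod C y = Dom C qC" using x cs by (simp_all add: cat_simps)
  have "BA G \<cdot> (qB \<cdot> x) = CA G \<cdot> (qC \<cdot> y)"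
    using x(6) x(1,2) cx cs by (simp add: comp_assoc)
  then obtain z where z: "z \<in> Arr C" "Dom C z = Dom C x" "Cod C z = Dom C (DB G)"
    "DB G \<cdot> z = qB \<cdot> x" "DC G \<cdot> z = qC \<cdot> y"
    using pullback_lift[OF pbG, of "qB \<cdot> x" "qC \<cdot> y"] x cx cs by (auto simp: cat_simps)
  obtain h where h: "h \<in> Arr C" "Dom C h = Dom C x" "Cod C h = Dom C (DB V)"
    "DB V \<cdot> h = x" "qD \<cdot> h = z"
    using pullback_lift[OF pbB, of x z] x cx z cs by auto
  obtain k where k: "k \<in> Arr C" "Dom C k = Dom C y" "Cod C k = Dom C (DC V)"
    "DC V \<cdot> k = y" "qD \<cdot> k = z"
    using pullback_lift[OF pbC, of y z] x cx z cs by auto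
  \<comment> \<open>Both arrows lift \<open>z\<close> along \<open>qD\<close>, but they come from
    different restriction squares; monicity of \<open>qD\<close> merges them.\<close>
  have "h = k"
    using h k x cs by - (rule monicD[OF M_monic[OF qD]]; auto)
  then show "\<exists>h. h \<in> Arr C \<and> Dom C h = Dom C x \<and> Cod C h = Dom C (DB V) \<and>
      DB V \<cdot> h = x \<and> DC V \<cdot> h = y"
    using h k by auto
next
  note pbB = rB[unfolded restriction_def]
  note cs = pbB[THEN pullback_comm, unfolded comm_square_iff]
  fix h k
  assume h: "h \<in> Arr C" "k \<in> Arr C" "Dom C h = Dom C k" "Cod C h = Dom C (DB V)"
    "Cod C k = Dom C (DB V)" "DB V \<cdot> h = DB V \<cdot> k" "DC V \<cdot> h = DC V \<cdot> k"
  note csG = pbG[THEN pullback_comm, unfolded comm_square_iff]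
  note csC = rC[unfolded restriction_def, THEN pullback_comm, unfolded comm_square_iff]
  have "DB G \<cdot> (qD \<cdot> h) = qB \<cdot> (DB V \<cdot> h)" "DB G \<cdot> (qD \<cdot> k) = qB \<cdot> (DB V \<cdot> k)"
    using h cs by - (rule comp_cong_right; auto)+
  moreover have "DC G \<cdot> (qD \<cdot> h) = qC \<cdot> (DC V \<cdot> h)" "DC G \<cdot> (qD \<cdot> k) = qC \<cdot> (DC V \<cdot> k)"
    using h cs csC by - (rule comp_cong_right; auto)+
  ultimately have "qD \<cdot> h = qD \<cdot> k"
    using h cs csG by - (rule pullback_joint_monic[OF pbG]; auto simp: cat_simps)
  then show "h = k"
    using h cs by - (rule monicD[OF M_monic[OF qD]]; auto)
qed

text \<open>Horizontal VK is read in the direction opposite to \<open>amalgamation_objI\<close>: the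
  top \<open>V\<close> is known to be a pushout, and the front faces come out as pullbacks. The
  universal property says nothing about the typing of \<open>qA\<close>, which is checked on the two
  legs of \<open>V\<close>.\<close>

lemma typed_morphism_amalgamation:
  assumes hvk: "horizontal_VK C M" and eff: "effective_pushouts C M" and TG: "edges TG \<subseteq> M"
    and poTG: "pushout_square C TG"
    and G: "amalgamation_obj C TG G gA gB gC gD" and V: "amalgamation_obj C TG V tA tB tC tD"
    and typed: "typed_morphism C tB gB qB" "typed_morphism C tC gC qC"
    and rB: "restriction C (DB G) qB (DB V) qD" and rC: "restriction C (DC G) qC (DC V) qD"
    and qs: "qB \<in> M" "qC \<in> M" "qD \<in> M"
  obtains qA where "qA \<in> M" "typed_morphism C tA gA qA" "amalgamation_obj C G V qA qB qC qD"
proof -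
  have edgesG: "edges G \<subseteq> M" and edgesV: "edges V \<subseteq> M"
    using G V TG amalgamation_obj_M by blast+
  have poG: "pushout_square C G" and poV: "pushout_square C V"
    using G V by (simp_all add: amalgamation_obj_def)
  have "pullback C (DB G) (DC G) (BA G) (CA G)"
    using poG edgesG by (intro pushout_pullback) (auto simp: pushout_square_def edges_def)
  from agree_pullback[OF this rB rC qs(3)]
  have pb: "pullback C (DB V) (DC V) (BA G \<cdot> qB) (CA G \<cdot> qC)" .
  note po = poV[unfolded pushout_square_def]
  note csG = poG[unfolded pushout_square_def, THEN pushout_comm, unfolded comm_square_iff]
  note csV = po[THEN pushout_comm, unfolded comm_square_iff]
  note csB = rB[unfolded restriction_def, THEN pullback_comm, unfolded comm_square_iff]
  note csC = rC[unfolded restriction_def, THEN pullback_comm, unfolded comm_square_iff]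
  have r: "restriction C (BA TG) gA (BA G) gB" "restriction C (CA TG) gA (CA G) gC"
    "restriction C (BA TG) tA (BA V) tB" "restriction C (CA TG) tA (CA V) tC"
    using G V by (simp_all add: amalgamation_obj_def)
  note cs = r[unfolded restriction_def, THEN pullback_comm, unfolded comm_square_iff]
  note ty = typed[unfolded typed_morphism_def hom_def, simplified]
  obtain qA where qA: "qA \<in> Arr C" "Dom C qA = Cod C (BA V)" "Cod C qA = Cod C (BA G)"
    "qA \<cdot> BA V = BA G \<cdot> qB" "qA \<cdot> CA V = CA G \<cdot> qC"
    using pushout_desc[OF po, of "BA G \<cdot> qB" "CA G \<cdot> qC"] csG csV csB csC
      pb[THEN pullback_comm, unfolded comm_square_iff]
    by (auto simp: cat_simps)
  have M: "BA G \<cdot> qB \<in> M" "CA G \<cdot> qC \<in> M"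
    using qs edgesG csG csB csC by (auto intro!: M_comp simp: edges_def)
  have "qA \<in> hom C (Cod C (BA V)) (Cod C (BA G \<cdot> qB))"
    using qA csG csB by (simp add: hom_def cat_simps)
  \<comment> \<open>The span out of the \<open>D\<close> part is at once the pullback of the two
    composites into the codomain of \<open>qA\<close> (\<open>pb\<close>) and the span of the
    pushout \<open>V\<close> (\<open>po\<close>), and \<open>qA\<close> is the mediating
    arrow.\<close>
  then have qM: "qA \<in> M"
    using eff M pb po qA unfolding effective_pushouts_def by blast
  have "(gA \<cdot> qA) \<cdot> BA V = (gA \<cdot> BA G) \<cdot> qB"
    using qA cs csB csG by - (rule comp_cong_left; auto)
  also have "\<dots> = BA TG \<cdot> tB"
    using cs ty by (simp add: comp_assoc)
  also have "\<dots> = tA \<cdot> BA V" using cs by simp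
  finally have eB: "(gA \<cdot> qA) \<cdot> BA V = tA \<cdot> BA V" .
  have "(gA \<cdot> qA) \<cdot> CA V = (gA \<cdot> CA G) \<cdot> qC"
    using qA cs csC csG csV by - (rule comp_cong_left; auto)
  also have "\<dots> = CA TG \<cdot> tC"
    using cs ty by (simp add: comp_assoc)
  also have "\<dots> = tA \<cdot> CA V" using cs by simp
  finally have eC: "(gA \<cdot> qA) \<cdot> CA V = tA \<cdot> CA V" .
  have "gA \<cdot> qA = tA"
    by (rule pushout_joint_epic[OF po])
      (use eB eC qA cs in \<open>simp_all add: cat_simps\<close>)
  then have tq: "typed_morphism C tA gA qA"
    using qA cs by (auto simp: typed_morphism_def hom_def)
  have "comm_cube C G V qA qB qC qD"
    unfolding comm_cube_def comm_square_iff
    using csG csV csB csC qA cs by auto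
  moreover have "back_faces_pb C G V qB qC qD"
    using rB rC by (simp add: back_faces_pb_def restriction_def)
  ultimately have "front_faces_pb C G V qA qB qC"
    using hvk poG poV edgesG edgesV unfolding horizontal_VK_def by blast
  then have "amalgamation_obj C G V qA qB qC qD"
    using rB rC poV
    by (simp add: amalgamation_obj_def agree_obj_def restriction_def front_faces_pb_def)
  then show thesis using that qM tq by blast
qed

text \<open>Since \<open>g \<cdot> q = tC\<close>, the restriction square of \<open>tC\<close> is an
  outer rectangle over that of \<open>g\<close>. The lift \<open>q'\<close> splits it, and
  cancellation in the pasting law makes the remaining square a pullback.\<close>

lemma typed_morphism_restriction:
  assumes g: "restriction C t g u g'" and tC: "restriction C t tC v tC'"
    and q: "typed_morphism C tC g q"
  obtains q' where "restriction C u q v q'"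
proof -
  note pbg = g[unfolded restriction_def] and pbt = tC[unfolded restriction_def]
  note cs = pbg[THEN pullback_comm, unfolded comm_square_iff]
    pbt[THEN pullback_comm, unfolded comm_square_iff]
  note ty = q[unfolded typed_morphism_def hom_def, simplified]
  have "g \<cdot> (q \<cdot> v) = t \<cdot> tC'"
    using cs ty comp_assoc[of v q g] by auto
  then obtain q' where q': "q' \<in> Arr C" "Dom C q' = Dom C v" "Cod C q' = Dom C u"
    "u \<cdot> q' = q \<cdot> v" "g' \<cdot> q' = tC'"
    using pullback_lift[OF pbg, of "q \<cdot> v" tC'] cs ty by (auto simp: cat_simps)
  have "pullback C (g' \<cdot> q') v t (g \<cdot> q) \<longleftrightarrow> pullback C q' v u q"
    by (rule pullback_paste_iff[OF pullback_flip[OF pbg]])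
      (use q' cs ty in \<open>simp add: comm_square_iff\<close>)
  then have "pullback C q' v u q" using pbt pullback_flip q' ty by metis
  then have "restriction C u q v q'" unfolding restriction_def by (rule pullback_flip)
  then show thesis by (rule that)
qed

end

section \<open>Restriction of conditions and solutions\<close>

lemma cond_restriction_simps:
  "cond_restriction C t u CTrue e ac' \<longleftrightarrow> e = ETrue \<and> ac' = CTrue"
  "cond_restriction C t u (CEx a tC ac) e ac' \<longleftrightarrow>
    (\<exists>v e1 a' tC' ac1. e = EEx v e1 \<and> ac' = CEx a' tC' ac1 \<and> restriction C t tC v tC' \<and>
      restriction C v a u a' \<and> cond_restriction C t v ac e1 ac1)"
  "cond_restriction C t u (CAnd I acs) e ac' \<longleftrightarrow>
    (\<exists>es acs'. e = EFam I es \<and> ac' = CAnd I acs' \<and>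
      (\<forall>i\<in>I. cond_restriction C t u (acs i) (es i) (acs' i)))"
  "cond_restriction C t u (COr I acs) e ac' \<longleftrightarrow>
    (\<exists>es acs'. e = EFam I es \<and> ac' = COr I acs' \<and>
      (\<forall>i\<in>I. cond_restriction C t u (acs i) (es i) (acs' i)))"
  by (subst cond_restriction.simps, simp, blast?)+

lemma solution_simps:
  "solution C M g p CTrue Q \<longleftrightarrow> Q = SEmpty"
  "solution C M g p (CEx a tC ac) Q \<longleftrightarrow>
    (\<exists>q Q1. Q = SEx q Q1 \<and> q \<in> M \<and> typed_morphism C tC g q \<and> q \<cdot>\<^bsub>C\<^esub> a = p \<and>
      solution C M g q ac Q1)"
  "solution C M g p (CAnd I acs) Q \<longleftrightarrow>
    (\<exists>Qs. Q = SFam I Qs \<and> (\<forall>i\<in>I. solution C M g p (acs i) (Qs i)))"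
  "solution C M g p (COr I acs) Q \<longleftrightarrow>
    (\<exists>Qs. Q = SFam I Qs \<and> (\<exists>j\<in>I. solution C M g p (acs j) (Qs j) \<and>
      (\<forall>k\<in>I. k \<noteq> j \<longrightarrow> Qs k = SEmpty)))"
  by (subst solution.simps, simp, blast?)+

text \<open>Used where a selected disjunct has an empty solution and so looks like an unselected
  one: the disjunct is then known to be \<open>CTrue\<close>.\<close>

lemma solution_SEmpty_iff: "solution C M g p ac SEmpty \<longleftrightarrow> ac = CTrue"
  by (subst solution.simps) auto

lemma sol_restriction_simps:
  "sol_restriction C u e SEmpty Q' \<longleftrightarrow> Q' = SEmpty"
  "sol_restriction C u e (SEx q Q) Q' \<longleftrightarrow>
    (\<exists>v e1 q' Q1. e = EEx v e1 \<and> Q' = SEx q' Q1 \<and> restriction C u q v q' \<and>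
      sol_restriction C u e1 Q Q1)"
  "sol_restriction C u e (SFam I Qs) Q' \<longleftrightarrow>
    (\<exists>es Qs'. e = EFam I es \<and> Q' = SFam I Qs' \<and>
      (\<forall>i\<in>I. sol_restriction C u (es i) (Qs i) (Qs' i)))"
  by (subst sol_restriction.simps, simp, blast?)+

lemma sol_restriction_to_SEmpty_iff: "sol_restriction C u e Q SEmpty \<longleftrightarrow> Q = SEmpty"
  by (subst sol_restriction.simps) auto

context M_adhesive_category
begin

text \<open>In the uniqueness proofs the outer arrows turn out equal, so the identity serves as the
  isomorphism at each level.\<close>

lemma sol_iso_same:
  assumes "q \<in> Arr C" "sol_iso C Q Q'"
  shows "sol_iso C (SEx q Q) (SEx q Q')"
proof (rule sol_iso.intros(2))
  show "iso C (Idt C (Dom C q))" "Idt C (Dom C q) \<in> hom C (Dom C q) (Dom C q)"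
    using assms by (simp_all add: iso_Idt id_hom dom_obj)
qed (use assms comp_Idt in auto)

text \<open>Pasting of pullbacks at every existential. The two condition restrictions give the trees
  a common shape and make the embeddings composable. This links the \<open>D\<close> part,
  restricted along the diagonal of \<open>G\<close>, to restrictions of the \<open>B\<close> and
  \<open>C\<close> parts.\<close>

lemma sol_restriction_comp_iff:
  assumes "cond_restriction C t w ac e ac'" "cond_restriction C t' w' ac' e' ac''"
    and "sol_restriction C u e Q Q'" "u \<in> M" "u' \<in> Arr C" "Cod C u' = Dom C u"
  shows "sol_restriction C (u \<cdot> u') (emb_comp C e e') Q Q'' \<longleftrightarrow> sol_restriction C u' e' Q' Q''"
  using assms(1-3)
proof (induction ac arbitrary: w e ac' w' e' ac'' Q Q' Q'')
  case CTrue
  then show ?case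
    by (cases Q) (auto simp: cond_restriction_simps sol_restriction_simps)
next
  case (CEx a s ac)
  from CEx.prems(1) obtain v e1 a' s' ac1 where 1: "e = EEx v e1" "ac' = CEx a' s' ac1"
    "restriction C t s v s'" "cond_restriction C t v ac e1 ac1"
    by (auto simp: cond_restriction_simps)
  from CEx.prems(2) 1 obtain v' e2 a'' s'' ac2 where 2: "e' = EEx v' e2" "ac'' = CEx a'' s'' ac2"
    "restriction C t' s' v' s''" "cond_restriction C t' v' ac1 e2 ac2"
    by (auto simp: cond_restriction_simps)
  show ?case
  proof (cases Q)
    case SEmpty
    then show ?thesis using CEx.prems(3) by (simp add: sol_restriction_simps)
  next
    case (SFam I Qs)
    then show ?thesis using CEx.prems(3) 1 by (simp add: sol_restriction_simps)
  next
    case (SEx q Q1)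
    then obtain q' Q1' where 3: "Q' = SEx q' Q1'" "restriction C u q v q'"
      "sol_restriction C u e1 Q1 Q1'"
      using CEx.prems(3) 1 by (auto simp: sol_restriction_simps)
    have IH: "sol_restriction C (u \<cdot> u') (emb_comp C e1 e2) Q1 R \<longleftrightarrow> sol_restriction C u' e2 Q1' R"
      for R by (rule CEx.IH[OF 1(4) 2(4) 3(3)])
    note cs = 3(2)[unfolded restriction_def, THEN pullback_comm, unfolded comm_square_iff]
      1(3)[unfolded restriction_def, THEN pullback_comm, unfolded comm_square_iff]
      2(3)[unfolded restriction_def, THEN pullback_comm, unfolded comm_square_iff]
    have "restriction C (u \<cdot> u') q (v \<cdot> v') q'' \<longleftrightarrow> restriction C u' q' v' q''" for q''
    proof -
      \<comment> \<open>Pasting presupposes that the inner square commutes. From the composite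
        square this follows only after cancelling the monic \<open>u\<close>.\<close>
      have "comm_square C v' q'' q' u'"
        if "comm_square C (v \<cdot> v') q'' q (u \<cdot> u')"
      proof -
        note cs' = that[unfolded comm_square_iff]
        have cod: "Cod C q'' = Dom C u'" "Dom C q'' = Dom C v'"
          using cs cs' assms(5,6) by (simp_all add: cat_simps)
        have "u \<cdot> (q' \<cdot> v') = q \<cdot> (v \<cdot> v')"
          using cs by - (rule comp_cong_right; auto)
        also have "\<dots> = u \<cdot> (u' \<cdot> q'')"
          using cs cs' cod assms(5,6) by (simp add: comp_assoc)
        finally have "q' \<cdot> v' = u' \<cdot> q''"
          using cs cs' cod assms(5,6)
          by - (rule monicD[OF M_monic[OF assms(4)]]; auto simp: cat_simps)
        then show ?thesis
          using cs cs' cod assms(5,6) by (simp add: comm_square_iff)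
      qed
      then show ?thesis
        using pullback_paste_iff[OF 3(2)[unfolded restriction_def], of v' q'' u']
        unfolding restriction_def by (metis pullback_comm)
    qed
    with IH show ?thesis
      using SEx 1(1) 2(1) 3(1) by (simp add: sol_restriction_simps)
  qed
next
  case (CAnd I acs)
  from CAnd.prems(1) obtain es acs' where 1: "e = EFam I es" "ac' = CAnd I acs'"
    "\<forall>i\<in>I. cond_restriction C t w (acs i) (es i) (acs' i)"
    by (auto simp: cond_restriction_simps)
  from CAnd.prems(2) 1 obtain es' acs'' where 2: "e' = EFam I es'" "ac'' = CAnd I acs''"
    "\<forall>i\<in>I. cond_restriction C t' w' (acs' i) (es' i) (acs'' i)"
    by (auto simp: cond_restriction_simps)
  have IH: "sol_restriction C (u \<cdot> u') (emb_comp C (es i) (es' i)) R R'' \<longleftrightarrow>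
      sol_restriction C u' (es' i) R' R''"
    if "i \<in> I" "sol_restriction C u (es i) R R'" for i R R' R''
    using that 1 2 by (intro CAnd.IH) auto
  show ?case
    using CAnd.prems(3) 1(1) 2(1)
    by (cases Q) (auto simp: sol_restriction_simps, use IH in blast, use IH in blast)
next
  case (COr I acs)
  from COr.prems(1) obtain es acs' where 1: "e = EFam I es" "ac' = COr I acs'"
    "\<forall>i\<in>I. cond_restriction C t w (acs i) (es i) (acs' i)"
    by (auto simp: cond_restriction_simps)
  from COr.prems(2) 1 obtain es' acs'' where 2: "e' = EFam I es'" "ac'' = COr I acs''"
    "\<forall>i\<in>I. cond_restriction C t' w' (acs' i) (es' i) (acs'' i)"
    by (auto simp: cond_restriction_simps)
  have IH: "sol_restriction C (u \<cdot> u') (emb_comp C (es i) (es' i)) R R'' \<longleftrightarrow>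
      sol_restriction C u' (es' i) R' R''"
    if "i \<in> I" "sol_restriction C u (es i) R R'" for i R R' R''
    using that 1 2 by (intro COr.IH) auto
  show ?case
    using COr.prems(3) 1(1) 2(1)
    by (cases Q) (auto simp: sol_restriction_simps, use IH in blast, use IH in blast)
qed

lemma sol_restriction_exists:
  assumes "restriction C t g u g'" "solution C M g p ac Q" "cond_restriction C t w ac e ac'"
  shows "\<exists>Q'. sol_restriction C u e Q Q'"
  using assms(2,3)
proof (induction ac arbitrary: p w Q e ac')
  case CTrue
  then show ?case by (auto simp: solution_simps sol_restriction_simps)
next
  case (CEx a s ac)
  from CEx.prems obtain q Q1 v e1 ac1 s' where *: "Q = SEx q Q1" "typed_morphism C s g q"
    "solution C M g q ac Q1" "e = EEx v e1" "restriction C t s v s'"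
    "cond_restriction C t v ac e1 ac1"
    by (auto simp: solution_simps cond_restriction_simps)
  obtain q' where "restriction C u q v q'"
    using typed_morphism_restriction[OF assms(1) *(5,2)] .
  moreover obtain Q1' where "sol_restriction C u e1 Q1 Q1'"
    using CEx.IH[OF *(3,6)] by blast
  ultimately show ?case using *(1,4) by (auto simp: sol_restriction_simps)
next
  case (CAnd I acs)
  from CAnd.prems obtain Qs es acs' where *: "Q = SFam I Qs" "e = EFam I es"
    "\<forall>i\<in>I. solution C M g p (acs i) (Qs i)"
    "\<forall>i\<in>I. cond_restriction C t w (acs i) (es i) (acs' i)"
    by (auto simp: solution_simps cond_restriction_simps)
  then have "\<forall>i\<in>I. \<exists>Q'. sol_restriction C u (es i) (Qs i) Q'"
    using CAnd.IH by blast
  then obtain Qs' where "\<forall>i\<in>I. sol_restriction C u (es i) (Qs i) (Qs' i)"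
    by metis
  then show ?case using * by (auto simp: sol_restriction_simps)
next
  case (COr I acs)
  from COr.prems obtain Qs es acs' j where *: "Q = SFam I Qs" "e = EFam I es" "j \<in> I"
    "solution C M g p (acs j) (Qs j)" "\<forall>i\<in>I. i \<noteq> j \<longrightarrow> Qs i = SEmpty"
    "\<forall>i\<in>I. cond_restriction C t w (acs i) (es i) (acs' i)"
    by (auto simp: solution_simps cond_restriction_simps)
  then have "\<exists>Q'. sol_restriction C u (es j) (Qs j) Q'"
    using COr.IH by blast
  \<comment> \<open>Unselected members need not be solutions, so the induction hypothesis does not
    cover them; \<open>SEmpty\<close> restricts to itself at any embedding.\<close>
  then have "\<forall>i\<in>I. \<exists>Q'. sol_restriction C u (es i) (Qs i) Q'"
    using *(5) sol_restriction_simps(1) by metis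
  then obtain Qs' where "\<forall>i\<in>I. sol_restriction C u (es i) (Qs i) (Qs' i)"
    by metis
  then show ?case using * by (auto simp: sol_restriction_simps)
qed

text \<open>Equations over the restricted objects are checked after the monics \<open>t\<close> and
  \<open>u\<close>, where they become the original ones. In the induction the restriction square of
  \<open>q\<close> takes the place of that of the match \<open>p\<close>.\<close>

lemma solution_restriction:
  assumes t: "t \<in> M" and g: "restriction C t g u g'"
    and "solution C M g p ac Q" "cond_restriction C t w ac e ac'" "sol_restriction C u e Q Q'"
    "restriction C u p w p'"
  shows "solution C M g' p' ac' Q'"
  using assms(3-6)
proof (induction ac arbitrary: p p' w Q Q' e ac')
  case CTrue
  then show ?case by (auto simp: solution_simps sol_restriction_simps cond_restriction_simps)
next
  case (CEx a s ac)
  from CEx.prems(1-3) obtain q Q1 v e1 ac1 a' s' q' Q1' where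
    *: "Q = SEx q Q1" "q \<in> M" "typed_morphism C s g q" "q \<cdot> a = p" "solution C M g q ac Q1"
    "e = EEx v e1" "ac' = CEx a' s' ac1" "restriction C t s v s'" "restriction C v a w a'"
    "cond_restriction C t v ac e1 ac1"
    "Q' = SEx q' Q1'" "restriction C u q v q'" "sol_restriction C u e1 Q1 Q1'"
    by (auto simp: solution_simps cond_restriction_simps sol_restriction_simps)
  have u: "u \<in> M" using g t by (rule restriction_M)
  note cs = g[unfolded restriction_def, THEN pullback_comm, unfolded comm_square_iff]
    *(8)[unfolded restriction_def, THEN pullback_comm, unfolded comm_square_iff]
    *(9)[unfolded restriction_def, THEN pullback_comm, unfolded comm_square_iff]
    *(12)[unfolded restriction_def, THEN pullback_comm, unfolded comm_square_iff]
    CEx.prems(4)[unfolded restriction_def, THEN pullback_comm, unfolded comm_square_iff]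
  note ty = *(3)[unfolded typed_morphism_def hom_def, simplified]
  have q': "q' \<in> M"
    using *(2,12) M_pullback_stable unfolding restriction_def by blast
  have "t \<cdot> (g' \<cdot> q') = g \<cdot> (u \<cdot> q')"
    using cs by - (rule comp_cong_right; auto)
  also have "\<dots> = g \<cdot> (q \<cdot> v)" using cs by simp
  also have "\<dots> = (g \<cdot> q) \<cdot> v"
    by (rule comp_assoc[symmetric]) (use cs ty in auto)
  also have "\<dots> = t \<cdot> s'" using cs ty by simp
  finally have "g' \<cdot> q' = s'"
    using cs by - (rule monicD[OF M_monic[OF t]]; auto simp: cat_simps)
  then have ty': "typed_morphism C s' g' q'"
    using cs by (auto simp: typed_morphism_def hom_def)
  have "u \<cdot> (q' \<cdot> a') = q \<cdot> (v \<cdot> a')"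
    using cs by - (rule comp_cong_right; auto)
  also have "\<dots> = q \<cdot> (a \<cdot> w)" using cs by simp
  also have "\<dots> = (q \<cdot> a) \<cdot> w" using cs by (simp add: comp_assoc)
  also have "\<dots> = u \<cdot> p'" using cs *(4) by simp
  finally have "q' \<cdot> a' = p'"
    using cs by - (rule monicD[OF M_monic[OF u]]; auto simp: cat_simps)
  then show ?case
    using *(7,11) q' ty' CEx.IH[OF *(5,10,13,12)] by (auto simp: solution_simps)
next
  case (CAnd I acs)
  then show ?case
    by (auto simp: solution_simps cond_restriction_simps sol_restriction_simps) blast
next
  case (COr I acs)
  from COr.prems(1-3) obtain Qs es acs' Qs' j where
    *: "Q' = SFam I Qs'" "ac' = COr I acs'" "j \<in> I"
    "solution C M g p (acs j) (Qs j)" "\<forall>i\<in>I. i \<noteq> j \<longrightarrow> Qs i = SEmpty"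
    "\<forall>i\<in>I. cond_restriction C t w (acs i) (es i) (acs' i)"
    "\<forall>i\<in>I. sol_restriction C u (es i) (Qs i) (Qs' i)"
    by (auto simp: solution_simps cond_restriction_simps sol_restriction_simps)
  have "solution C M g' p' (acs' j) (Qs' j)"
    using COr.IH[OF _ *(4)] * COr.prems(4) by blast
  moreover have "\<forall>i\<in>I. i \<noteq> j \<longrightarrow> Qs' i = SEmpty"
    using *(5,7) by (metis sol_restriction_simps(1))
  ultimately show ?case
    using *(1-3) by (auto simp: solution_simps)
qed

text \<open>Fixed embeddings leave no freedom: two restricted arrows of \<open>q\<close> both
  compose with \<open>u\<close> to \<open>q \<cdot> v\<close>, and \<open>u\<close> is
  monic.\<close>

lemma sol_restriction_unique:
  assumes "u \<in> M" "sol_restriction C u e Q Q1" "sol_restriction C u e Q Q2"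
  shows "sol_iso C Q1 Q2"
  using assms(2,3)
proof (induction arbitrary: Q2 rule: sol_restriction.induct)
  case (1 e)
  then show ?case by (auto simp: sol_restriction_simps intro: sol_iso.intros)
next
  case (2 q v q' e Q Q')
  from 2(4) obtain q'' Q'' where *: "Q2 = SEx q'' Q''" "restriction C u q v q''"
    "sol_restriction C u e Q Q''"
    by (auto simp: sol_restriction_simps)
  note cs = 2(1)[unfolded restriction_def, THEN pullback_comm, unfolded comm_square_iff]
    *(2)[unfolded restriction_def, THEN pullback_comm, unfolded comm_square_iff]
  have "q' = q''"
    using cs by - (rule monicD[OF M_monic[OF assms(1)]]; auto)
  then show ?case
    using * cs 2(3) by (auto intro: sol_iso_same)
next
  case (3 I es Qs Qs')
  then show ?case by (auto simp: sol_restriction_simps intro!: sol_iso.intros(3))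
qed

end

section \<open>Amalgamation of conditions and solutions\<close>

lemma amalgamation_cond_CTrue:
  assumes "amalgamation_cond C TG P E tA tB tC tD CTrue acB acC acD"
  shows "acB = CTrue" "acC = CTrue" "acD = CTrue"
  using assms by (auto simp: amalgamation_cond_def cond_restriction_simps)

text \<open>All conjuncts live over the same pushout \<open>P\<close>, so only the embedding trees
  split, into one square \<open>F i\<close> per index.\<close>

lemma amalgamation_cond_CAnd:
  assumes "amalgamation_cond C TG P E tA tB tC tD (CAnd I acsA) acB acC acD"
  obtains F acsB acsC acsD where
    "DB E = EFam I (\<lambda>i. DB (F i))" "DC E = EFam I (\<lambda>i. DC (F i))"
    "BA E = EFam I (\<lambda>i. BA (F i))" "CA E = EFam I (\<lambda>i. CA (F i))"
    "acB = CAnd I acsB" "acC = CAnd I acsC" "acD = CAnd I acsD"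
    "\<forall>i\<in>I.
      amalgamation_cond C TG P (F i) tA tB tC tD (acsA i) (acsB i) (acsC i) (acsD i)"
proof -
  note a = assms[unfolded amalgamation_cond_def]
  from a obtain eBA acsB where B: "BA E = EFam I eBA" "acB = CAnd I acsB"
    "\<forall>i\<in>I. cond_restriction C (BA TG) (BA P) (acsA i) (eBA i) (acsB i)"
    by (auto simp: cond_restriction_simps)
  from a obtain eCA acsC where C: "CA E = EFam I eCA" "acC = CAnd I acsC"
    "\<forall>i\<in>I. cond_restriction C (CA TG) (CA P) (acsA i) (eCA i) (acsC i)"
    by (auto simp: cond_restriction_simps)
  from a B obtain eDB acsD where D: "DB E = EFam I eDB" "acD = CAnd I acsD"
    "\<forall>i\<in>I. cond_restriction C (DB TG) (DB P) (acsB i) (eDB i) (acsD i)"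
    by (auto simp: cond_restriction_simps)
  from a C D obtain eDC where D': "DC E = EFam I eDC"
    "\<forall>i\<in>I. cond_restriction C (DC TG) (DC P) (acsC i) (eDC i) (acsD i)"
    by (auto simp: cond_restriction_simps)
  \<comment> \<open>The composites are equal as functions; evaluated inside \<open>I\<close>, the
    normalising default of \<open>emb_comp\<close> disappears.\<close>
  have "\<forall>i\<in>I. emb_comp C (eBA i) (eDB i) = emb_comp C (eCA i) (eDC i)"
    using a B C D D' by (auto dest: fun_cong split: if_splits)
  then show thesis
    using a B C D D'
    by (intro that[of "\<lambda>i. \<lparr>DB = eDB i, DC = eDC i, BA = eBA i, CA = eCA i\<rparr>" acsB acsC acsD])
      (auto simp: amalgamation_cond_def)
qed

lemma amalgamation_cond_COr:
  assumes "amalgamation_cond C TG P E tA tB tC tD (COr I acsA) acB acC acD"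
  obtains F acsB acsC acsD where
    "DB E = EFam I (\<lambda>i. DB (F i))" "DC E = EFam I (\<lambda>i. DC (F i))"
    "BA E = EFam I (\<lambda>i. BA (F i))" "CA E = EFam I (\<lambda>i. CA (F i))"
    "acB = COr I acsB" "acC = COr I acsC" "acD = COr I acsD"
    "\<forall>i\<in>I.
      amalgamation_cond C TG P (F i) tA tB tC tD (acsA i) (acsB i) (acsC i) (acsD i)"
proof -
  note a = assms[unfolded amalgamation_cond_def]
  from a obtain eBA acsB where B: "BA E = EFam I eBA" "acB = COr I acsB"
    "\<forall>i\<in>I. cond_restriction C (BA TG) (BA P) (acsA i) (eBA i) (acsB i)"
    by (auto simp: cond_restriction_simps)
  from a obtain eCA acsC where C: "CA E = EFam I eCA" "acC = COr I acsC"
    "\<forall>i\<in>I. cond_restriction C (CA TG) (CA P) (acsA i) (eCA i) (acsC i)"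
    by (auto simp: cond_restriction_simps)
  from a B obtain eDB acsD where D: "DB E = EFam I eDB" "acD = COr I acsD"
    "\<forall>i\<in>I. cond_restriction C (DB TG) (DB P) (acsB i) (eDB i) (acsD i)"
    by (auto simp: cond_restriction_simps)
  from a C D obtain eDC where D': "DC E = EFam I eDC"
    "\<forall>i\<in>I. cond_restriction C (DC TG) (DC P) (acsC i) (eDC i) (acsD i)"
    by (auto simp: cond_restriction_simps)
  have "\<forall>i\<in>I. emb_comp C (eBA i) (eDB i) = emb_comp C (eCA i) (eDC i)"
    using a B C D D' by (auto dest: fun_cong split: if_splits)
  then show thesis
    using a B C D D'
    by (intro that[of "\<lambda>i. \<lparr>DB = eDB i, DC = eDC i, BA = eBA i, CA = eCA i\<rparr>" acsB acsC acsD])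
      (auto simp: amalgamation_cond_def)
qed

context M_adhesive_category
begin

text \<open>This is where the nested pushout \<open>V\<close> arises. Its commutativity is read off
  the heads of the two equal embedding composites, and their tails give the coherence of
  \<open>F\<close>.\<close>

lemma amalgamation_cond_CEx:
  assumes hvk: "horizontal_VK C M" and po: "pushout_square C TG" and TG: "edges TG \<subseteq> M"
    and "amalgamation_cond C TG P E tA tB tC tD (CEx aA sA acA) acB acC acD"
  obtains V F aB aC aD sB sC sD acB' acC' acD' where
    "DB E = EEx (DB V) (DB F)" "DC E = EEx (DC V) (DC F)"
    "BA E = EEx (BA V) (BA F)" "CA E = EEx (CA V) (CA F)"
    "acB = CEx aB sB acB'" "acC = CEx aC sC acC'" "acD = CEx aD sD acD'"
    "restriction C (BA V) aA (BA P) aB" "restriction C (CA V) aA (CA P) aC"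
    "amalgamation_cond C TG V F sA sB sC sD acA acB' acC' acD'"
proof -
  note a = assms(4)[unfolded amalgamation_cond_def]
  from a obtain vBA eBA aB sB acB' where B: "BA E = EEx vBA eBA" "acB = CEx aB sB acB'"
    "restriction C (BA TG) sA vBA sB" "restriction C vBA aA (BA P) aB"
    "cond_restriction C (BA TG) vBA acA eBA acB'"
    by (auto simp: cond_restriction_simps)
  from a obtain vCA eCA aC sC acC' where C: "CA E = EEx vCA eCA" "acC = CEx aC sC acC'"
    "restriction C (CA TG) sA vCA sC" "restriction C vCA aA (CA P) aC"
    "cond_restriction C (CA TG) vCA acA eCA acC'"
    by (auto simp: cond_restriction_simps)
  from a B obtain vDB eDB aD sD acD' where D: "DB E = EEx vDB eDB" "acD = CEx aD sD acD'"
    "restriction C (DB TG) sB vDB sD" "cond_restriction C (DB TG) vDB acB' eDB acD'"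
    by (auto simp: cond_restriction_simps)
  from a C D obtain vDC eDC where D': "DC E = EEx vDC eDC"
    "restriction C (DC TG) sC vDC sD" "cond_restriction C (DC TG) vDC acC' eDC acD'"
    by (auto simp: cond_restriction_simps)
  let ?V = "\<lparr>DB = vDB, DC = vDC, BA = vBA, CA = vCA\<rparr>"
  let ?F = "\<lparr>DB = eDB, DC = eDC, BA = eBA, CA = eCA\<rparr>"
  have eq: "vBA \<cdot> vDB = vCA \<cdot> vDC" "emb_comp C eBA eDB = emb_comp C eCA eDC"
    using a B C D D' by auto
  have "amalgamation_obj C TG ?V sA sB sC sD"
    by (rule amalgamation_objI[OF hvk po TG]) (use B C D D' eq in simp_all)
  then have "amalgamation_cond C TG ?V ?F sA sB sC sD acA acB' acC' acD'"
    using a B C D D' eq by (simp add: amalgamation_cond_def)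
  then show thesis
    using B C D D' by (intro that[of ?V ?F]) auto
qed

text \<open>An amalgamated \<open>qA\<close> is determined by the legs of \<open>V\<close>, with no
  reference to \<open>aA\<close>. The triangle with \<open>pA\<close> is therefore tested on the
  jointly epic legs of \<open>P\<close>, where it reduces to the triangles of the \<open>B\<close>
  and \<open>C\<close> parts.\<close>

lemma amalgamation_match:
  assumes P: "pushout_square C P" and p: "amalgamation_obj C G P pA pB pC pD"
    and q: "amalgamation_obj C G V qA qB qC qD"
    and a: "restriction C (BA V) aA (BA P) aB" "restriction C (CA V) aA (CA P) aC"
    and eq: "qB \<cdot> aB = pB" "qC \<cdot> aC = pC"
  shows "qA \<cdot> aA = pA"
proof (rule pushout_joint_epic[OF P[unfolded pushout_square_def]])
  have r: "restriction C (BA G) pA (BA P) pB" "restriction C (CA G) pA (CA P) pC"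
    "restriction C (BA G) qA (BA V) qB" "restriction C (CA G) qA (CA V) qC"
    using p q by (simp_all add: amalgamation_obj_def)
  note cs = r[unfolded restriction_def, THEN pullback_comm, unfolded comm_square_iff]
    a[unfolded restriction_def, THEN pullback_comm, unfolded comm_square_iff]
  show "qA \<cdot> aA \<in> Arr C" "pA \<in> Arr C" "Cod C (qA \<cdot> aA) = Cod C pA"
    "Dom C (qA \<cdot> aA) = Cod C (BA P)" "Dom C pA = Cod C (BA P)"
    using cs by (simp_all add: cat_simps)
  have "(qA \<cdot> aA) \<cdot> BA P = (qA \<cdot> BA V) \<cdot> aB"
    using cs by - (rule comp_cong_left; auto)
  also have "\<dots> = BA G \<cdot> (qB \<cdot> aB)" using cs by (simp add: comp_assoc)
  also have "\<dots> = pA \<cdot> BA P" using cs eq by simp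
  finally show "(qA \<cdot> aA) \<cdot> BA P = pA \<cdot> BA P" .
  have "(qA \<cdot> aA) \<cdot> CA P = (qA \<cdot> CA V) \<cdot> aC"
    using cs by - (rule comp_cong_left; auto)
  also have "\<dots> = CA G \<cdot> (qC \<cdot> aC)" using cs by (simp add: comp_assoc)
  also have "\<dots> = pA \<cdot> CA P" using cs eq by simp
  finally show "(qA \<cdot> aA) \<cdot> CA P = pA \<cdot> CA P" .
qed

text \<open>The induction generalises over \<open>P\<close>, the typings and the matches, because
  the subcondition of an existential lives over \<open>V\<close> with the arrows \<open>q\<close> as
  its matches; \<open>typed_morphism_amalgamation\<close> provides their amalgamation.\<close>

lemma amalgamation_sol_exists:
  assumes hvk: "horizontal_VK C M" and eff: "effective_pushouts C M"
    and po: "pushout_square C TG" and TG: "edges TG \<subseteq> M"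
    and G: "amalgamation_obj C TG G gA gB gC gD"
    and "amalgamation_cond C TG P E tA tB tC tD acA acB acC acD"
    and "amalgamation_obj C G P pA pB pC pD"
    and "solution C M gB pB acB QB" "solution C M gC pC acC QC" "solution C M gD pD acD QD"
    and "agree_sol C G E QB QC QD"
  shows "\<exists>QA. amalgamation_sol C M G E gA pA acA QA QB QC QD"
  using assms(6-)
proof (induction acA arbitrary: P E tA tB tC tD pA pB pC pD acB acC acD QB QC QD)
  case CTrue
  then show ?case
    using amalgamation_cond_CTrue[OF CTrue.prems(1)]
    by (auto simp: amalgamation_sol_def agree_sol_def solution_simps sol_restriction_simps)
next
  case (CEx aA sA acA)
  note agr = CEx.prems(6)[unfolded agree_sol_def]
  obtain V F aB aC aD sB sC sD acB' acC' acD' where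
    E: "DB E = EEx (DB V) (DB F)" "DC E = EEx (DC V) (DC F)"
      "BA E = EEx (BA V) (BA F)" "CA E = EEx (CA V) (CA F)"
    and ac: "acB = CEx aB sB acB'" "acC = CEx aC sC acC'" "acD = CEx aD sD acD'"
    and a: "restriction C (BA V) aA (BA P) aB" "restriction C (CA V) aA (CA P) aC"
    and sub: "amalgamation_cond C TG V F sA sB sC sD acA acB' acC' acD'"
    using amalgamation_cond_CEx[OF hvk po TG CEx.prems(1)] .
  obtain qB QB' where B: "QB = SEx qB QB'" "qB \<in> M" "typed_morphism C sB gB qB" "qB \<cdot> aB = pB"
    "solution C M gB qB acB' QB'"
    using CEx.prems(3) ac by (auto simp: solution_simps)
  obtain qC QC' where C: "QC = SEx qC QC'" "qC \<in> M" "typed_morphism C sC gC qC" "qC \<cdot> aC = pC"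
    "solution C M gC qC acC' QC'"
    using CEx.prems(4) ac by (auto simp: solution_simps)
  obtain qD QD' where D: "QD = SEx qD QD'" "qD \<in> M" "solution C M gD qD acD' QD'"
    using CEx.prems(5) ac by (auto simp: solution_simps)
  have r: "restriction C (DB G) qB (DB V) qD" "restriction C (DC G) qC (DC V) qD"
    and agr': "agree_sol C G F QB' QC' QD'"
    using agr E B(1) C(1) D(1) by (auto simp: agree_sol_def sol_restriction_simps)
  have V: "amalgamation_obj C TG V sA sB sC sD" and P: "pushout_square C P"
    using sub CEx.prems(1) by (auto simp: amalgamation_cond_def amalgamation_obj_def)
  obtain qA where qA: "qA \<in> M" "typed_morphism C sA gA qA" "amalgamation_obj C G V qA qB qC qD"
    using typed_morphism_amalgamation[OF hvk eff TG po G V B(3) C(3) r B(2) C(2) D(2)] .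
  obtain QA where QA: "amalgamation_sol C M G F gA qA acA QA QB' QC' QD'"
    using CEx.IH[OF sub qA(3) B(5) C(5) D(3) agr'] by blast
  have "qA \<cdot> aA = pA"
    by (rule amalgamation_match[OF P CEx.prems(2) qA(3) a B(4) C(4)])
  then have "amalgamation_sol C M G E gA pA (CEx aA sA acA) (SEx qA QA) QB QC QD"
    using QA qA E B(1) C(1) CEx.prems(6)
    by (auto simp: amalgamation_sol_def solution_simps sol_restriction_simps amalgamation_obj_def)
  then show ?case by blast
next
  case (CAnd I acsA)
  obtain F acsB acsC acsD where
    E: "DB E = EFam I (\<lambda>i. DB (F i))" "DC E = EFam I (\<lambda>i. DC (F i))"
      "BA E = EFam I (\<lambda>i. BA (F i))" "CA E = EFam I (\<lambda>i. CA (F i))"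
    and ac: "acB = CAnd I acsB" "acC = CAnd I acsC" "acD = CAnd I acsD"
    and sub: "\<forall>i\<in>I.
      amalgamation_cond C TG P (F i) tA tB tC tD (acsA i) (acsB i) (acsC i) (acsD i)"
    using amalgamation_cond_CAnd[OF CAnd.prems(1)] .
  obtain QsB QsC QsD where Q: "QB = SFam I QsB" "QC = SFam I QsC" "QD = SFam I QsD"
    "\<forall>i\<in>I. solution C M gB pB (acsB i) (QsB i)"
    "\<forall>i\<in>I. solution C M gC pC (acsC i) (QsC i)"
    "\<forall>i\<in>I. solution C M gD pD (acsD i) (QsD i)"
    using CAnd.prems(3-5) ac by (auto simp: solution_simps)
  have agr: "agree_sol C G (F i) (QsB i) (QsC i) (QsD i)" if "i \<in> I" for i
    using CAnd.prems(6) that E Q by (auto simp: agree_sol_def sol_restriction_simps)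
  have "\<exists>QA. amalgamation_sol C M G (F i) gA pA (acsA i) QA (QsB i) (QsC i) (QsD i)"
    if "i \<in> I" for i
    using CAnd.IH[OF _ sub[rule_format, OF that] CAnd.prems(2) Q(4-6)[rule_format, OF that] agr[OF that]] by blast
  then obtain QsA where
    "\<forall>i\<in>I.
      amalgamation_sol C M G (F i) gA pA (acsA i) (QsA i) (QsB i) (QsC i) (QsD i)"
    by metis
  then have "amalgamation_sol C M G E gA pA (CAnd I acsA) (SFam I QsA) QB QC QD"
    using E Q(1-3) CAnd.prems(6)
    by (auto simp: amalgamation_sol_def solution_simps sol_restriction_simps)
  then show ?case by blast
next
  case (COr I acsA)
  obtain F acsB acsC acsD where
    E: "DB E = EFam I (\<lambda>i. DB (F i))" "DC E = EFam I (\<lambda>i. DC (F i))"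
      "BA E = EFam I (\<lambda>i. BA (F i))" "CA E = EFam I (\<lambda>i. CA (F i))"
    and ac: "acB = COr I acsB" "acC = COr I acsC" "acD = COr I acsD"
    and sub: "\<forall>i\<in>I.
      amalgamation_cond C TG P (F i) tA tB tC tD (acsA i) (acsB i) (acsC i) (acsD i)"
    using amalgamation_cond_COr[OF COr.prems(1)] .
  obtain QsB j where B: "QB = SFam I QsB" "j \<in> I" "solution C M gB pB (acsB j) (QsB j)"
    "\<forall>k\<in>I. k \<noteq> j \<longrightarrow> QsB k = SEmpty"
    using COr.prems(3) ac by (auto simp: solution_simps)
  obtain QsC jC where C: "QC = SFam I QsC" "jC \<in> I" "solution C M gC pC (acsC jC) (QsC jC)"
    "\<forall>k\<in>I. k \<noteq> jC \<longrightarrow> QsC k = SEmpty"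
    using COr.prems(4) ac by (auto simp: solution_simps)
  obtain QsD jD where D: "QD = SFam I QsD" "jD \<in> I" "solution C M gD pD (acsD jD) (QsD jD)"
    "\<forall>k\<in>I. k \<noteq> jD \<longrightarrow> QsD k = SEmpty"
    using COr.prems(5) ac by (auto simp: solution_simps)
  have agr: "agree_sol C G (F i) (QsB i) (QsC i) (QsD i)" if "i \<in> I" for i
    using COr.prems(6) that E B(1) C(1) D(1) by (auto simp: agree_sol_def sol_restriction_simps)
  then have empty: "QsD i = SEmpty \<longleftrightarrow> QsB i = SEmpty" "QsD i = SEmpty \<longleftrightarrow> QsC i = SEmpty"
    if "i \<in> I" for i
    using that by (metis agree_sol_def sol_restriction_simps(1) sol_restriction_to_SEmpty_iff)+
  \<comment> \<open>If the three solutions select different disjuncts, they are all empty and the selected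
    disjuncts are \<open>CTrue\<close>.\<close>
  have QA: "\<exists>QA. solution C M gA pA (acsA j) QA \<and>
      sol_restriction C (BA G) (BA (F j)) QA (QsB j) \<and> sol_restriction C (CA G) (CA (F j)) QA (QsC j)"
  proof (cases "QsB j = SEmpty")
    case True
    then have "acsB j = CTrue" using B(3) by (simp add: solution_SEmpty_iff)
    then have "acsA j = CTrue"
      using sub[rule_format, OF B(2)] by (cases "acsA j") (auto simp: amalgamation_cond_def cond_restriction_simps)
    moreover have "QsC j = SEmpty" using True empty B(2) by blast
    ultimately show ?thesis
      using True by (auto simp: solution_simps sol_restriction_simps)
  next
    case False
    \<comment> \<open>An index is empty in all three parts or in none, so a nonempty member at
      \<open>j\<close> must be the selected one everywhere.\<close>
    then have "jC = j" "jD = j" using empty B(2) C(4) D(4) by metis+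
    then show ?thesis
      using COr.IH[OF _ sub[rule_format, OF B(2)] COr.prems(2) B(3) _ _ agr[OF B(2)]] C(3) D(3)
      unfolding amalgamation_sol_def by blast
  qed
  then obtain QA where QA: "solution C M gA pA (acsA j) QA"
    "sol_restriction C (BA G) (BA (F j)) QA (QsB j)" "sol_restriction C (CA G) (CA (F j)) QA (QsC j)"
    by blast
  \<comment> \<open>The \<open>C\<close> part may have selected another index, so its emptiness away
    from \<open>j\<close> is inferred from the \<open>B\<close> part through
    \<open>D\<close>.\<close>
  have "QsB i = SEmpty \<and> QsC i = SEmpty" if "i \<in> I" "i \<noteq> j" for i
    using that B(4) empty by blast
  with QA have "amalgamation_sol C M G E gA pA (COr I acsA)
      (SFam I (\<lambda>i. if i = j then QA else SEmpty)) QB QC QD"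
    using E B(1,2) C(1) COr.prems(6)
    by (auto simp: amalgamation_sol_def solution_simps sol_restriction_simps intro!: bexI[of _ j])
  then show ?case by blast
qed

text \<open>Two candidates for \<open>qA\<close> agree on both legs of \<open>V\<close>, hence are
  equal. The matches \<open>pA\<close> and \<open>pA'\<close> are kept independent, so that the
  induction hypothesis applies to \<open>q\<close> and \<open>q'\<close> as they are.\<close>

lemma amalgamation_sol_unique:
  assumes hvk: "horizontal_VK C M" and po: "pushout_square C TG" and TG: "edges TG \<subseteq> M"
    and "amalgamation_cond C TG P E tA tB tC tD acA acB acC acD"
    and "solution C M gA pA acA QA" "solution C M gA pA' acA QA'"
    and "sol_restriction C (BA G) (BA E) QA QB" "sol_restriction C (CA G) (CA E) QA QC"
    and "sol_restriction C (BA G) (BA E) QA' QB" "sol_restriction C (CA G) (CA E) QA' QC"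
  shows "sol_iso C QA QA'"
  using assms(4-)
proof (induction acA arbitrary: P E tA tB tC tD pA pA' acB acC acD QA QA' QB QC)
  case CTrue
  then show ?case by (auto simp: solution_simps intro: sol_iso.intros)
next
  case (CEx aA sA acA)
  obtain V F aB aC aD sB sC sD acB' acC' acD' where
    E: "DB E = EEx (DB V) (DB F)" "DC E = EEx (DC V) (DC F)"
      "BA E = EEx (BA V) (BA F)" "CA E = EEx (CA V) (CA F)"
    and ac: "acB = CEx aB sB acB'" "acC = CEx aC sC acC'" "acD = CEx aD sD acD'"
    and a: "restriction C (BA V) aA (BA P) aB" "restriction C (CA V) aA (CA P) aC"
    and sub: "amalgamation_cond C TG V F sA sB sC sD acA acB' acC' acD'"
    using amalgamation_cond_CEx[OF hvk po TG CEx.prems(1)] .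
  obtain q R where q: "QA = SEx q R" "solution C M gA q acA R"
    using CEx.prems(2) by (auto simp: solution_simps)
  obtain q' R' where q': "QA' = SEx q' R'" "solution C M gA q' acA R'"
    using CEx.prems(3) by (auto simp: solution_simps)
  obtain qB RB where B: "QB = SEx qB RB" "restriction C (BA G) q (BA V) qB"
    "restriction C (BA G) q' (BA V) qB" "sol_restriction C (BA G) (BA F) R RB"
    "sol_restriction C (BA G) (BA F) R' RB"
    using CEx.prems(4,6) q(1) q'(1) E by (auto simp: sol_restriction_simps)
  obtain qC RC where C: "QC = SEx qC RC" "restriction C (CA G) q (CA V) qC"
    "restriction C (CA G) q' (CA V) qC" "sol_restriction C (CA G) (CA F) R RC"
    "sol_restriction C (CA G) (CA F) R' RC"
    using CEx.prems(5,7) q(1) q'(1) E by (auto simp: sol_restriction_simps)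
  have V: "pushout C (DB V) (DC V) (BA V) (CA V)"
    using sub by (simp add: amalgamation_cond_def amalgamation_obj_def pushout_square_def)
  note cs = B(2,3)[unfolded restriction_def, THEN pullback_comm, unfolded comm_square_iff]
    C(2,3)[unfolded restriction_def, THEN pullback_comm, unfolded comm_square_iff]
  have "q = q'"
    by (rule pushout_joint_epic[OF V]) (use cs in auto)
  then show ?case
    using CEx.IH[OF sub q(2) q'(2) B(4) C(4) B(5) C(5)] q(1) q'(1) cs
    by (auto intro: sol_iso_same)
next
  case (CAnd I acsA)
  obtain F acsB acsC acsD where
    E: "DB E = EFam I (\<lambda>i. DB (F i))" "DC E = EFam I (\<lambda>i. DC (F i))"
      "BA E = EFam I (\<lambda>i. BA (F i))" "CA E = EFam I (\<lambda>i. CA (F i))"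
    and sub: "\<forall>i\<in>I.
      amalgamation_cond C TG P (F i) tA tB tC tD (acsA i) (acsB i) (acsC i) (acsD i)"
    using amalgamation_cond_CAnd[OF CAnd.prems(1)] by metis
  obtain Qs Qs' QsB QsC where Q: "QA = SFam I Qs" "QA' = SFam I Qs'"
    and sol: "\<forall>i\<in>I. solution C M gA pA (acsA i) (Qs i)"
      "\<forall>i\<in>I. solution C M gA pA' (acsA i) (Qs' i)"
    and res: "\<forall>i\<in>I. sol_restriction C (BA G) (BA (F i)) (Qs i) (QsB i)"
      "\<forall>i\<in>I. sol_restriction C (CA G) (CA (F i)) (Qs i) (QsC i)"
      "\<forall>i\<in>I. sol_restriction C (BA G) (BA (F i)) (Qs' i) (QsB i)"
      "\<forall>i\<in>I. sol_restriction C (CA G) (CA (F i)) (Qs' i) (QsC i)"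
    using CAnd.prems(2-) E by (auto simp: solution_simps sol_restriction_simps)
  have "sol_iso C (Qs i) (Qs' i)" if i: "i \<in> I" for i
    by (rule CAnd.IH[OF _ sub[rule_format, OF i] sol[rule_format, OF i] res[rule_format, OF i]]) simp
  then show ?case using Q by (auto intro: sol_iso.intros)
next
  case (COr I acsA)
  obtain F acsB acsC acsD where
    E: "DB E = EFam I (\<lambda>i. DB (F i))" "DC E = EFam I (\<lambda>i. DC (F i))"
      "BA E = EFam I (\<lambda>i. BA (F i))" "CA E = EFam I (\<lambda>i. CA (F i))"
    and sub: "\<forall>i\<in>I.
      amalgamation_cond C TG P (F i) tA tB tC tD (acsA i) (acsB i) (acsC i) (acsD i)"
    using amalgamation_cond_COr[OF COr.prems(1)] by metis
  obtain Qs Qs' QsB QsC j j' where Q: "QA = SFam I Qs" "QA' = SFam I Qs'"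
    and sol: "solution C M gA pA (acsA j) (Qs j)" "solution C M gA pA' (acsA j') (Qs' j')"
    and emp: "\<forall>i\<in>I. i \<noteq> j \<longrightarrow> Qs i = SEmpty" "\<forall>i\<in>I. i \<noteq> j' \<longrightarrow> Qs' i = SEmpty"
    and res: "\<forall>i\<in>I. sol_restriction C (BA G) (BA (F i)) (Qs i) (QsB i)"
      "\<forall>i\<in>I. sol_restriction C (CA G) (CA (F i)) (Qs i) (QsC i)"
      "\<forall>i\<in>I. sol_restriction C (BA G) (BA (F i)) (Qs' i) (QsB i)"
      "\<forall>i\<in>I. sol_restriction C (CA G) (CA (F i)) (Qs' i) (QsC i)"
    using COr.prems(2-) E by (auto simp: solution_simps sol_restriction_simps)
  have "sol_iso C (Qs i) (Qs' i)" if i: "i \<in> I" for i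
  proof (cases "i = j \<and> i = j'")
    case True
    then show ?thesis
      using sol by (intro COr.IH[OF _ sub[rule_format, OF i] _ _ res[rule_format, OF i]]) auto
  next
    case False
    \<comment> \<open>The two solutions may have selected different disjuncts. Emptiness of one
      member passes to the other through their common restriction \<open>QsB i\<close>.\<close>
    then have "Qs i = SEmpty \<or> Qs' i = SEmpty" using i emp by blast
    then have "QsB i = SEmpty" using res(1,3)[rule_format, OF i] by (auto simp: sol_restriction_simps)
    then have "Qs i = SEmpty" "Qs' i = SEmpty"
      using res(1,3)[rule_format, OF i] by (auto simp: sol_restriction_to_SEmpty_iff)
    then show ?thesis by (simp add: sol_iso.intros)
  qed
  then show ?case using Q by (auto intro: sol_iso.intros)
qed

end

section \<open>Composition, decomposition and uniqueness over a fixed amalgamation\<close>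

theorem theorem4p10:
  fixes C :: "('o, 'm) cat" and M :: "'m set"
    and TG G P :: "'m square"
    and gA gB gC gD tA tB tC tD pA pB pC pD :: 'm
    and E :: "('i, 'm) emb square"
    and acA acB acC acD :: "('i, 'm) cond"
  assumes "M_adhesive_category C M"
    and "horizontal_VK C M"
    and "effective_pushouts C M"
    and "pushout_square C TG" and "edges TG \<subseteq> M"
    and "amalgamation_obj C TG G gA gB gC gD"
    and "amalgamation_cond C TG P E tA tB tC tD acA acB acC acD"
    and "typed_morphism C tA gA pA" and "typed_morphism C tB gB pB"
    and "typed_morphism C tC gC pC" and "typed_morphism C tD gD pD"
    and "amalgamation_obj C G P pA pB pC pD"
  shows
    "(\<forall>QB QC QD.
        solution C M gB pB acB QB \<and> solution C M gC pC acC QC \<and> solution C M gD pD acD QD \<and>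
        agree_sol C G E QB QC QD \<longrightarrow>
        (\<exists>QA. amalgamation_sol C M G E gA pA acA QA QB QC QD) \<and>
        (\<forall>QA QA'. amalgamation_sol C M G E gA pA acA QA QB QC QD \<and>
           amalgamation_sol C M G E gA pA acA QA' QB QC QD \<longrightarrow> sol_iso C QA QA')) \<and>
     (\<forall>QA. solution C M gA pA acA QA \<longrightarrow>
        (\<exists>QB QC QD. restrictions_sol C G E QA QB QC QD) \<and>
        (\<forall>QB QC QD. restrictions_sol C G E QA QB QC QD \<longrightarrow>
           solution C M gB pB acB QB \<and> solution C M gC pC acC QC \<and> solution C M gD pD acD QD \<and>
           amalgamation_sol C M G E gA pA acA QA QB QC QD) \<and>
        (\<forall>QB QC QD QB' QC' QD'. amalgamation_sol C M G E gA pA acA QA QB QC QD \<and>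
           amalgamation_sol C M G E gA pA acA QA QB' QC' QD' \<longrightarrow>
           sol_iso C QB QB' \<and> sol_iso C QC QC' \<and> sol_iso C QD QD'))"
proof -
  interpret M_adhesive_category C M by (rule assms(1))
  note hvk = assms(2) and po = assms(4) and TG = assms(5) and G = assms(6) and ac = assms(7)
    and p = assms(12)
  note ac' = ac[unfolded amalgamation_cond_def] and G' = G[unfolded amalgamation_obj_def agree_obj_def]
    and p' = p[unfolded amalgamation_obj_def agree_obj_def]
  have edges: "BA G \<in> M" "CA G \<in> M" "DB G \<in> M" "DC G \<in> M"
    "BA TG \<in> M" "CA TG \<in> M" "DB TG \<in> M" "DC TG \<in> M"
    using amalgamation_obj_M[OF G TG] TG by (auto simp: edges_def)
  have cs: "comm_square C (DB G) (DC G) (BA G) (CA G)"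
    using G' by (auto simp: pushout_square_def intro: pushout_comm)
  have eq: "BA G \<cdot>\<^bsub>C\<^esub> DB G = CA G \<cdot>\<^bsub>C\<^esub> DC G"
    "emb_comp C (BA E) (DB E) = emb_comp C (CA E) (DC E)"
    using cs ac' by (simp_all add: comm_square_iff)
  have cr: "cond_restriction C (BA TG) (BA P) acA (BA E) acB"
    "cond_restriction C (CA TG) (CA P) acA (CA E) acC"
    "cond_restriction C (DB TG) (DB P) acB (DB E) acD"
    "cond_restriction C (DC TG) (DC P) acC (DC E) acD"
    using ac' by simp_all
  have DB_iff: "sol_restriction C (BA G \<cdot>\<^bsub>C\<^esub> DB G) (emb_comp C (BA E) (DB E)) QA QD \<longleftrightarrow>
      sol_restriction C (DB G) (DB E) QB QD"
    if "sol_restriction C (BA G) (BA E) QA QB" for QA QB QD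
    by (rule sol_restriction_comp_iff[OF cr(1,3) that edges(1)])
      (use cs in \<open>simp_all add: comm_square_iff\<close>)
  \<comment> \<open>By \<open>eq\<close> the diagonal may equally be taken through \<open>C\<close>,
    so a single restriction along it is a restriction of both \<open>QB\<close> and
    \<open>QC\<close>, which is their agreement in \<open>QD\<close>.\<close>
  have DC_iff: "sol_restriction C (BA G \<cdot>\<^bsub>C\<^esub> DB G) (emb_comp C (BA E) (DB E)) QA QD \<longleftrightarrow>
      sol_restriction C (DC G) (DC E) QC QD"
    if "sol_restriction C (CA G) (CA E) QA QC" for QA QC QD
    unfolding eq by (rule sol_restriction_comp_iff[OF cr(2,4) that edges(2)])
      (use cs in \<open>simp_all add: comm_square_iff\<close>)
  have sol_BC: "solution C M gB pB acB QB" "solution C M gC pC acC QC"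
    if "solution C M gA pA acA QA"
      "sol_restriction C (BA G) (BA E) QA QB" "sol_restriction C (CA G) (CA E) QA QC" for QA QB QC
    using solution_restriction[OF _ _ that(1) _ that(2)] solution_restriction[OF _ _ that(1) _ that(3)]
      edges ac' G' p' by blast+
  have sol_D: "solution C M gD pD acD QD"
    if "solution C M gB pB acB QB" "sol_restriction C (DB G) (DB E) QB QD" for QB QD
    using solution_restriction[OF _ _ that(1) _ that(2)] edges ac' G' p' by blast
  show ?thesis
  proof (intro conjI allI impI)
    fix QB QC QD
    assume "solution C M gB pB acB QB \<and> solution C M gC pC acC QC \<and> solution C M gD pD acD QD \<and>
      agree_sol C G E QB QC QD"
    then show "\<exists>QA. amalgamation_sol C M G E gA pA acA QA QB QC QD"
      using amalgamation_sol_exists[OF hvk assms(3) po TG G ac p] by blast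
  next
    fix QB QC QD QA QA'
    assume "amalgamation_sol C M G E gA pA acA QA QB QC QD \<and>
      amalgamation_sol C M G E gA pA acA QA' QB QC QD"
    then show "sol_iso C QA QA'"
      using amalgamation_sol_unique[OF hvk po TG ac] unfolding amalgamation_sol_def by blast
  next
    fix QA
    assume QA: "solution C M gA pA acA QA"
    obtain QB where B: "sol_restriction C (BA G) (BA E) QA QB"
      using sol_restriction_exists[OF _ QA] ac' G' by blast
    obtain QC where C: "sol_restriction C (CA G) (CA E) QA QC"
      using sol_restriction_exists[OF _ QA] ac' G' by blast
    \<comment> \<open>\<open>QD\<close> is built in two stages, through \<open>QB\<close>;
      \<open>DB_iff\<close> turns it into the restriction of \<open>QA\<close> along the
      diagonal.\<close>
    obtain QD where "sol_restriction C (DB G) (DB E) QB QD"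
      using sol_restriction_exists[OF _ sol_BC(1)[OF QA B C]] ac' G' by blast
    then show "\<exists>QB QC QD. restrictions_sol C G E QA QB QC QD"
      using B C DB_iff unfolding restrictions_sol_def by blast
  next
    fix QA QB QC QD
    assume QA: "solution C M gA pA acA QA" and "restrictions_sol C G E QA QB QC QD"
    then have r: "sol_restriction C (BA G) (BA E) QA QB" "sol_restriction C (CA G) (CA E) QA QC"
      and D: "sol_restriction C (DB G) (DB E) QB QD" "sol_restriction C (DC G) (DC E) QC QD"
      using DB_iff DC_iff unfolding restrictions_sol_def by blast+
    show B: "solution C M gB pB acB QB" and "solution C M gC pC acC QC"
      using sol_BC[OF QA r] by simp_all
    show "solution C M gD pD acD QD"
      using sol_D[OF B D(1)] .
    show "amalgamation_sol C M G E gA pA acA QA QB QC QD"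
      using QA r D by (simp add: amalgamation_sol_def agree_sol_def)
  next
    fix QA QB QC QD QB' QC' QD'
    assume "amalgamation_sol C M G E gA pA acA QA QB QC QD \<and>
      amalgamation_sol C M G E gA pA acA QA QB' QC' QD'"
    then have r: "sol_restriction C (BA G) (BA E) QA QB" "sol_restriction C (CA G) (CA E) QA QC"
      "sol_restriction C (DB G) (DB E) QB QD" "sol_restriction C (BA G) (BA E) QA QB'"
      "sol_restriction C (CA G) (CA E) QA QC'" "sol_restriction C (DB G) (DB E) QB' QD'"
      by (simp_all add: amalgamation_sol_def agree_sol_def)
    show "sol_iso C QB QB'" "sol_iso C QC QC'"
      using r edges sol_restriction_unique by blast+
    \<comment> \<open>\<open>QD\<close> and \<open>QD'\<close> restrict possibly different solutions
      \<open>QB\<close> and \<open>QB'\<close>. They become comparable as restrictions of the same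
      \<open>QA\<close> along the diagonal, which is again in \<open>M\<close>.\<close>
    have "BA G \<cdot>\<^bsub>C\<^esub> DB G \<in> M"
      using edges cs by (auto intro!: M_comp simp: comm_square_iff)
    then show "sol_iso C QD QD'"
      using r DB_iff sol_restriction_unique by blast
  qed
qed

end
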